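(* Let $F$ be a non-archimedean local field, $G=\mathrm{PGL}(2,F)$, $T$ the diagonal torus of $G$, and $\psi_F$ a non-trivial smooth character of $(F,+)$. i) For all $f\in c\text{-}\mathrm{ind}_T^G 1_T$ and $g\in G$, the function $f_g:F\to\mathbb C$, $t\mapsto f(gu(t))$, is locally constant and has compact support. ii) For all $f\in c\text{-}\mathrm{ind}_T^G1_T$, set $$W_f(g)=\int_F f(gu(t))\,\overline{\psi_F}(t)\,dt,\qquad g\in G.$$ Then $\Phi: c\text{-}\mathrm{ind}_T^G1_T\to \mathrm{Wh}_\theta$, $f\mapsto W_f$, is an injective $G$-equivariant map.
   Context: $U$ is the unipotent radical of the upper triangular Borel subgroup of $G$, and $u(t)$ is the image in $G$ of $\begin{pmatrix}1&t\\0&1\end{pmatrix}$, $t\in F$. $\theta$ is the character of $U$ defined by $\theta(u(t))=\psi_F(t)$. $\overline{\psi_F}$ is the complex conjugate of $\psi_F$ and $dt$ is a Haar measure on $F$. $c\text{-}\mathrm{ind}_T^G1_T$ is the compactly induced representation of the trivial character of $T$: the space of functions $f:G\to\mathbb C$ that are right $T$-invariant, invariant under left translation by some open subgroup of $G$, and supported in $CT$ for some compact $C\subset G$. $\mathrm{Wh}_\theta=\mathrm{Ind}_U^G\theta$ (smooth induction) is the space of functions $W:G\to\mathbb C$ with $W(gu)=\theta(u)W(g)$ for $g\in G$, $u\in U$, invariant under left translation by some open subgroup of $G$. On both spaces $G$ acts by left translation. *)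

theory Defs
  imports "HOL-Analysis.Analysis" "HOL-Algebra.Coset"
begin

section \<open>Non-archimedean local fields\<close>

text \<open>
  A non-archimedean local field is a field with a non-trivial ultrametric absolute value
  for which it is locally compact (equivalently: complete, discretely valued, with finite
  residue field). The absolute value of \<open>x\<close> is \<open>dist x 0\<close>; the constant
  \<^const>\<open>norm\<close> is not available here because it is reserved for real normed vector spaces.
\<close>

class nonarch_local_field = field + metric_space +
  assumes dist_translate: "dist (x + z) (y + z) = dist x y"
    and dist_zero_mult: "dist (x * y) 0 = dist x 0 * dist y 0"
    and dist_zero_ultrametric: "dist (x + y) 0 \<le> max (dist x 0) (dist y 0)"
    and dist_zero_nontrivial: "\<exists>x. x \<noteq> 0 \<and> dist x 0 \<noteq> 1"
    and locally_compact_field: "\<exists>U K. open U \<and> compact K \<and> x \<in> U \<and> U \<subseteq> K"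

definition locally_constant :: "('a::topological_space \<Rightarrow> 'b) \<Rightarrow> bool" where
  "locally_constant f \<longleftrightarrow> (\<forall>x. \<exists>V. open V \<and> x \<in> V \<and> f constant_on V)"

definition compactly_supported :: "('a::topological_space \<Rightarrow> complex) \<Rightarrow> bool" where
  "compactly_supported f \<longleftrightarrow> compact (closure {x. f x \<noteq> 0})"

text \<open>Characters take values in the non-zero complex numbers; unitarity is not assumed.\<close>

definition smooth_character :: "('a::nonarch_local_field \<Rightarrow> complex) \<Rightarrow> bool" where
  "smooth_character \<psi> \<longleftrightarrow>
     (\<forall>x y. \<psi> (x + y) = \<psi> x * \<psi> y) \<and> (\<forall>x. \<psi> x \<noteq> 0) \<and> locally_constant \<psi>"

text \<open>
  No regularity condition is needed: the field is a locally compact, sigma-compact metric space,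
  so every Borel measure on it that is finite on compact sets is regular.
\<close>

definition haar_measure :: "'a::nonarch_local_field measure \<Rightarrow> bool" where
  "haar_measure \<mu> \<longleftrightarrow>
     sets \<mu> = sets borel \<and>
     (\<forall>A\<in>sets borel. \<forall>x. emeasure \<mu> ((\<lambda>t. x + t) ` A) = emeasure \<mu> A) \<and>
     (\<forall>K. compact K \<longrightarrow> emeasure \<mu> K < \<infinity>) \<and>
     emeasure \<mu> UNIV \<noteq> 0"

section \<open>The topological group PGL(2,F)\<close>

definition GL2 :: "('a::field ^ 2 ^ 2) monoid" where
  "GL2 = \<lparr>carrier = {A. invertible A}, mult = (**), one = mat 1\<rparr>"

definition scalars :: "('a::field ^ 2 ^ 2) set" where
  "scalars = {mat c | c. c \<noteq> 0}"

type_synonym 'a pgl2 = "('a ^ 2 ^ 2) set"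

definition PGL2 :: "'a::field pgl2 monoid" where
  "PGL2 = GL2 Mod scalars"

definition proj :: "'a::field ^ 2 ^ 2 \<Rightarrow> 'a pgl2" where
  "proj A = scalars #>\<^bsub>GL2\<^esub> A"

text \<open>
  The quotient topology along \<^const>\<open>proj\<close>, where the invertible matrices carry the subspace
  topology from the space of all matrices; see \<open>quotient_map_proj\<close> below.
\<close>

definition PGL2_top :: "'a::nonarch_local_field pgl2 topology" where
  "PGL2_top = topology (\<lambda>S. S \<subseteq> carrier PGL2 \<and>
     openin (top_of_set (carrier GL2)) {A \<in> carrier GL2. proj A \<in> S})"

definition torus :: "'a::field pgl2 set" where
  "torus = {proj (vector [vector [a, 0], vector [0, d]]) | a d. a \<noteq> 0 \<and> d \<noteq> 0}"

definition uni :: "'a::field \<Rightarrow> 'a pgl2" where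
  "uni t = proj (vector [vector [1, t], vector [0, 1]])"

text \<open>The unipotent radical of the upper triangular Borel subgroup.\<close>

definition unipotent :: "'a::field pgl2 set" where
  "unipotent = range uni"

section \<open>Induced representations\<close>

text \<open>
  Functions on the group are represented by functions that are \<^const>\<open>undefined\<close> outside its
  carrier, so that equality of such functions is equality on the group.
\<close>

definition smooth_fun :: "('a::nonarch_local_field pgl2 \<Rightarrow> complex) \<Rightarrow> bool" where
  "smooth_fun f \<longleftrightarrow> (\<exists>K. subgroup K PGL2 \<and> openin PGL2_top K \<and>
     (\<forall>k\<in>K. \<forall>g\<in>carrier PGL2. f (k \<otimes>\<^bsub>PGL2\<^esub> g) = f g))"

definition smooth_Ind ::
    "'a::nonarch_local_field pgl2 set \<Rightarrow> ('a pgl2 \<Rightarrow> complex) \<Rightarrow> ('a pgl2 \<Rightarrow> complex) set" where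
  "smooth_Ind H \<sigma> = {f \<in> carrier PGL2 \<rightarrow>\<^sub>E UNIV. smooth_fun f \<and>
     (\<forall>g\<in>carrier PGL2. \<forall>h\<in>H. f (g \<otimes>\<^bsub>PGL2\<^esub> h) = \<sigma> h * f g)}"

definition compact_Ind ::
    "'a::nonarch_local_field pgl2 set \<Rightarrow> ('a pgl2 \<Rightarrow> complex) \<Rightarrow> ('a pgl2 \<Rightarrow> complex) set" where
  "compact_Ind H \<sigma> = {f \<in> smooth_Ind H \<sigma>.
     \<exists>C. compactin PGL2_top C \<and> {g \<in> carrier PGL2. f g \<noteq> 0} \<subseteq> C <#>\<^bsub>PGL2\<^esub> H}"

definition cind_torus :: "('a::nonarch_local_field pgl2 \<Rightarrow> complex) set" where
  "cind_torus = compact_Ind torus (\<lambda>_. 1)"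

text \<open>
  The character of the unipotent group determined by \<open>uni t \<mapsto> \<psi> t\<close>; see
  \<open>theta_uni\<close> below.
\<close>

definition theta :: "('a::field \<Rightarrow> complex) \<Rightarrow> 'a pgl2 \<Rightarrow> complex" where
  "theta \<psi> h = \<psi> (the_inv uni h)"

definition Wh :: "('a::nonarch_local_field \<Rightarrow> complex) \<Rightarrow> ('a pgl2 \<Rightarrow> complex) set" where
  "Wh \<psi> = smooth_Ind unipotent (theta \<psi>)"

definition left_translate ::
    "'a::field pgl2 \<Rightarrow> ('a pgl2 \<Rightarrow> complex) \<Rightarrow> 'a pgl2 \<Rightarrow> complex" where
  "left_translate h f = (\<lambda>g\<in>carrier PGL2. f (inv\<^bsub>PGL2\<^esub> h \<otimes>\<^bsub>PGL2\<^esub> g))"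

definition whittaker_map ::
    "'a::nonarch_local_field measure \<Rightarrow> ('a \<Rightarrow> complex) \<Rightarrow> ('a pgl2 \<Rightarrow> complex)
      \<Rightarrow> 'a pgl2 \<Rightarrow> complex" where
  "whittaker_map \<mu> \<psi> f =
     (\<lambda>g\<in>carrier PGL2. \<integral>t. f (g \<otimes>\<^bsub>PGL2\<^esub> uni t) * cnj (\<psi> t) \<partial>\<mu>)"

section \<open>Consistency of the definitions\<close>

lemma group_GL2: "group (GL2 :: ('a::field ^ 2 ^ 2) monoid)"
proof (rule groupI)
  fix A :: "'a ^ 2 ^ 2" assume "A \<in> carrier GL2"
  then obtain B where "A ** B = mat 1" "B ** A = mat 1"
    unfolding GL2_def invertible_def by auto
  then show "\<exists>B\<in>carrier GL2. B \<otimes>\<^bsub>GL2\<^esub> A = \<one>\<^bsub>GL2\<^esub>"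
    unfolding GL2_def invertible_def by auto
next
  have "invertible (mat 1 :: 'a ^ 2 ^ 2)"
    unfolding invertible_def by (rule exI[of _ "mat 1"]) simp
  then show "\<one>\<^bsub>GL2\<^esub> \<in> carrier (GL2 :: ('a ^ 2 ^ 2) monoid)"
    by (simp add: GL2_def)
qed (simp_all add: GL2_def invertible_mult matrix_mul_assoc)

lemma mat_mult_left: "mat c ** A = (\<chi> i j. c * (A :: 'a::field ^ 2 ^ 2) $ i $ j)"
  by (simp add: vec_eq_iff matrix_matrix_mult_def mat_def forall_2 sum_2)

lemma mat_mult_right: "A ** mat c = (\<chi> i j. c * (A :: 'a::field ^ 2 ^ 2) $ i $ j)"
  by (simp add: vec_eq_iff matrix_matrix_mult_def mat_def forall_2 sum_2)

lemma mat_mult_mat: "mat a ** mat b = (mat (a * b) :: 'a::field ^ 2 ^ 2)"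
  by (simp add: vec_eq_iff matrix_matrix_mult_def mat_def forall_2 sum_2)

lemma invertible_scalar: "c \<noteq> 0 \<Longrightarrow> invertible (mat c :: 'a::field ^ 2 ^ 2)"
  unfolding invertible_def by (rule exI[of _ "mat (inverse c)"]) (simp add: mat_mult_mat)

lemma normal_scalars: "scalars \<lhd> (GL2 :: ('a::field ^ 2 ^ 2) monoid)"
proof -
  interpret GL2: group "GL2 :: ('a ^ 2 ^ 2) monoid" by (rule group_GL2)
  have "subgroup (scalars :: ('a ^ 2 ^ 2) set) GL2"
  proof (rule GL2.subgroupI)
    show "(scalars :: ('a ^ 2 ^ 2) set) \<subseteq> carrier GL2"
      by (auto simp: scalars_def GL2_def invertible_scalar)
    have "(mat 1 :: 'a ^ 2 ^ 2) \<in> scalars"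
      unfolding scalars_def by (rule CollectI, rule exI[of _ 1]) simp
    then show "(scalars :: ('a ^ 2 ^ 2) set) \<noteq> {}" by (metis empty_iff)
  next
    fix A :: "'a ^ 2 ^ 2" assume "A \<in> scalars"
    then obtain c where c: "A = mat c" "c \<noteq> 0" by (auto simp: scalars_def)
    have "inv\<^bsub>GL2\<^esub> A = mat (inverse c)"
      using c by (intro GL2.inv_equality) (auto simp: GL2_def mat_mult_mat invertible_scalar)
    then show "inv\<^bsub>GL2\<^esub> A \<in> scalars" using c by (auto simp: scalars_def)
  next
    fix A B :: "'a ^ 2 ^ 2" assume "A \<in> scalars" "B \<in> scalars"
    then obtain a b where ab: "A = mat a" "B = mat b" "a \<noteq> 0" "b \<noteq> 0"
      by (auto simp: scalars_def)
    then have "A ** B = mat (a * b)" "a * b \<noteq> 0" by (simp_all add: mat_mult_mat)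
    then show "A \<otimes>\<^bsub>GL2\<^esub> B \<in> scalars" by (auto simp: scalars_def GL2_def)
  qed
  then show ?thesis
  proof (rule GL2.normalI)
    show "\<forall>x\<in>carrier GL2. scalars #>\<^bsub>GL2\<^esub> x = x <#\<^bsub>GL2\<^esub> (scalars :: ('a ^ 2 ^ 2) set)"
      by (auto simp: r_coset_def l_coset_def scalars_def GL2_def mat_mult_left mat_mult_right)
  qed
qed

lemma group_PGL2: "group (PGL2 :: 'a::field pgl2 monoid)"
  unfolding PGL2_def by (rule normal.factorgroup_is_group[OF normal_scalars])

lemma proj_hom: "proj \<in> hom GL2 (PGL2 :: 'a::field pgl2 monoid)"
  using normal.r_coset_hom_Mod[OF normal_scalars[where 'a='a]]
  unfolding PGL2_def proj_def[abs_def] .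

lemma carrier_PGL2: "carrier PGL2 = proj ` carrier GL2"
  by (simp add: PGL2_def carrier_FactGroup proj_def[abs_def])

lemma proj_eq_iff:
  assumes "A \<in> carrier GL2" "B \<in> carrier GL2"
  shows "proj A = proj (B :: 'a::field ^ 2 ^ 2) \<longleftrightarrow> (\<exists>c. c \<noteq> 0 \<and> B = mat c ** A)"
proof -
  interpret GL2: group "GL2 :: ('a ^ 2 ^ 2) monoid" by (rule group_GL2)
  have sg: "subgroup (scalars :: ('a ^ 2 ^ 2) set) GL2"
    using normal_scalars by (rule normal_imp_subgroup)
  have "proj A = proj B \<longleftrightarrow> B \<in> proj A"
    unfolding proj_def using GL2.repr_independence[OF _ _ sg] GL2.rcos_self[OF _ sg] assms
    by metis
  also have "\<dots> \<longleftrightarrow> (\<exists>c. c \<noteq> 0 \<and> B = mat c ** A)"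
    by (auto simp: proj_def r_coset_def scalars_def GL2_def)
  finally show ?thesis .
qed

lemma openin_PGL2_top:
  "openin (PGL2_top :: 'a::nonarch_local_field pgl2 topology) S \<longleftrightarrow> S \<subseteq> carrier PGL2 \<and>
     openin (top_of_set (carrier GL2)) {A \<in> carrier GL2. proj A \<in> S}"
proof -
  have "istopology (\<lambda>S :: 'a pgl2 set. S \<subseteq> carrier PGL2 \<and>
     openin (top_of_set (carrier GL2)) {A \<in> carrier GL2. proj A \<in> S})" (is "istopology ?L")
    unfolding istopology_def
  proof (intro conjI allI impI)
    fix S T assume "?L S" "?L T"
    moreover have "{A \<in> carrier GL2. proj A \<in> S \<inter> T} =
        {A \<in> carrier GL2. proj A \<in> S} \<inter> {A \<in> carrier GL2. proj A \<in> T}"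
      by blast
    ultimately show "S \<inter> T \<subseteq> carrier PGL2"
      "openin (top_of_set (carrier GL2)) {A \<in> carrier GL2. proj A \<in> S \<inter> T}"
      by (auto simp del: Int_iff)
  next
    fix \<K> assume "\<forall>K\<in>\<K>. ?L K"
    moreover have "{A \<in> carrier GL2. proj A \<in> \<Union>\<K>} =
        (\<Union>K\<in>\<K>. {A \<in> carrier GL2. proj A \<in> K})"
      by blast
    ultimately show "\<Union>\<K> \<subseteq> carrier PGL2"
      "openin (top_of_set (carrier GL2)) {A \<in> carrier GL2. proj A \<in> \<Union>\<K>}"
      by (auto simp del: Union_iff)
  qed
  then show ?thesis unfolding PGL2_top_def by (simp add: topology_inverse')
qed

lemma topspace_PGL2_top [simp]:
  "topspace PGL2_top = carrier (PGL2 :: 'a::nonarch_local_field pgl2 monoid)"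
proof
  show "topspace PGL2_top \<subseteq> carrier (PGL2 :: 'a pgl2 monoid)"
    using openin_PGL2_top openin_topspace by blast
  have "{A \<in> carrier GL2. proj A \<in> carrier PGL2} = (carrier GL2 :: ('a ^ 2 ^ 2) set)"
    by (auto simp: carrier_PGL2)
  then have "openin PGL2_top (carrier (PGL2 :: 'a pgl2 monoid))"
    by (simp add: openin_PGL2_top)
  then show "carrier (PGL2 :: 'a pgl2 monoid) \<subseteq> topspace PGL2_top"
    by (rule openin_subset)
qed

lemma quotient_map_proj:
  "quotient_map (top_of_set (carrier GL2)) (PGL2_top :: 'a::nonarch_local_field pgl2 topology) proj"
  by (auto simp: quotient_map_def openin_PGL2_top carrier_PGL2)

lemma uni_matrix_in_GL2:
  "vector [vector [1, t], vector [0, 1]] \<in> carrier (GL2 :: ('a::field ^ 2 ^ 2) monoid)"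
  by (simp add: GL2_def invertible_det_nz det_2)

lemma uni_in_PGL2: "uni t \<in> carrier PGL2"
  unfolding uni_def carrier_PGL2 using uni_matrix_in_GL2 by blast

lemma inj_uni: "inj (uni :: 'a::field \<Rightarrow> 'a pgl2)"
proof (rule injI)
  fix s t :: 'a assume "uni s = uni t"
  then obtain c where "(vector [vector [1, t], vector [0, 1]] :: 'a ^ 2 ^ 2) =
      mat c ** vector [vector [1, s], vector [0, 1]]"
    unfolding uni_def using proj_eq_iff[OF uni_matrix_in_GL2 uni_matrix_in_GL2] by blast
  then show "s = t"
    by (simp add: mat_mult_left vec_eq_iff forall_2)
qed

lemma theta_uni [simp]: "theta \<psi> (uni t) = \<psi> t"
  unfolding theta_def by (simp add: the_inv_f_f[OF inj_uni])

end

(*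
  For f in the compactly induced space and g in G, the function f_g(t) = f(g u(t)) is uniformly
  locally constant because g u(s) g^-1 lies in the open stabiliser of f for small s, and it has
  bounded support because G/T is the space of pairs of distinct points of the projective line: a
  function measuring their distance is bounded on the support of f and unbounded along g u(t).

  For injectivity, g diag(a,1) u(t) = g u(at) diag(a,1), so W_f = 0 forces the Fourier transform of
  f_g to vanish at all characters t |-> psi(bt) with b nonzero, hence also at b = 0 since it is
  locally constant in b. By Stone-Weierstrass the span of these characters is dense in the
  continuous functions on any compact ball, so f_g integrates to 0 over all small balls.
*)
theory Submission
  imports Defs
begin

section \<open>The field\<close>

abbreviation absval :: "'a::nonarch_local_field \<Rightarrow> real" where
  "absval x \<equiv> dist x 0"

lemma dist_eq_absval: "dist x y = absval (x - y :: 'a::nonarch_local_field)"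
  using dist_translate[of x "-y" y] by simp

lemma absval_minus [simp]: "absval (- x :: 'a::nonarch_local_field) = absval x"
  using dist_translate[of "-x" x 0] by (simp add: dist_commute)

lemma absval_mult: "absval (x * y :: 'a::nonarch_local_field) = absval x * absval y"
  by (rule dist_zero_mult)

lemma absval_add_le: "absval (x + y :: 'a::nonarch_local_field) \<le> absval x + absval y"
  using dist_zero_ultrametric[of x y] by (smt (verit) zero_le_dist)

lemma absval_le_add_diff: "absval (x :: 'a::nonarch_local_field) \<le> absval (x + y) + absval y"
  using absval_add_le[of "x + y" "- y"] by simp

lemma absval_one [simp]: "absval (1 :: 'a::nonarch_local_field) = 1"
  using dist_zero_mult[of "1::'a" 1] by simp

lemma absval_inverse: "absval (inverse x :: 'a::nonarch_local_field) = inverse (absval x)"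
proof (cases "x = 0")
  case False
  then have "absval x * absval (inverse x) = 1"
    using absval_mult[of x "inverse x"] by simp
  then show ?thesis
    by (metis inverse_unique)
qed simp

lemma absval_power: "absval (x ^ n :: 'a::nonarch_local_field) = absval x ^ n"
  by (induction n) (simp_all add: absval_mult)

instance nonarch_local_field \<subseteq> topological_ab_group_add
proof
  fix a b :: 'a
  let ?F = "nhds a \<times>\<^sub>F nhds b"
  have "((\<lambda>x. dist (fst x) a + dist (snd x) b) \<longlongrightarrow> dist a a + dist b b) ?F"
    by (intro tendsto_intros filterlim_fst filterlim_snd)
  then have "((\<lambda>x. dist (fst x) a + dist (snd x) b) \<longlongrightarrow> 0) ?F"
    by simp
  moreover have "dist (x + y) (a + b) \<le> dist x a + dist y b" for x y :: 'a
    using absval_add_le[of "x - a" "y - b"]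
    by (simp add: dist_eq_absval[of x a] dist_eq_absval[of y b] dist_eq_absval[of "x + y"] algebra_simps)
  ultimately show "LIM x ?F. fst x + snd x :> nhds (a + b)"
    by (intro metric_tendsto_imp_tendsto[where b = "a + b"])
      (auto intro!: always_eventually order_trans[OF _ abs_ge_self])
  have "dist (- x) (- a) = dist x a" for x
    using absval_minus[of "x - a"] by (simp add: dist_eq_absval[of "- x"] dist_eq_absval[of x a])
  then show "(uminus \<longlongrightarrow> - a) (nhds a)"
    by (intro metric_tendsto_imp_tendsto[OF filterlim_ident]) simp
qed

instance nonarch_local_field \<subseteq> topological_semigroup_mult
proof
  fix a b :: 'a
  let ?F = "nhds a \<times>\<^sub>F nhds b"
  have "((\<lambda>x. dist (fst x) a * dist (snd x) b + (dist (fst x) a * absval b + absval a * dist (snd x) b))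
      \<longlongrightarrow> dist a a * dist b b + (dist a a * absval b + absval a * dist b b)) ?F"
    by (intro tendsto_intros filterlim_fst filterlim_snd)
  then have "((\<lambda>x. dist (fst x) a * dist (snd x) b +
      (dist (fst x) a * absval b + absval a * dist (snd x) b)) \<longlongrightarrow> 0) ?F"
    by simp
  moreover have "dist (x * y) (a * b) \<le> dist x a * dist y b + (dist x a * absval b + absval a * dist y b)"
    for x y :: 'a
  proof -
    have eq: "x * y - a * b = (x - a) * (y - b) + ((x - a) * b + a * (y - b))"
      by (simp add: algebra_simps)
    have "absval (x * y - a * b) \<le>
        absval ((x - a) * (y - b)) + (absval ((x - a) * b) + absval (a * (y - b)))"
      unfolding eq
      using absval_add_le[of "(x - a) * (y - b)" "(x - a) * b + a * (y - b)"]
        absval_add_le[of "(x - a) * b" "a * (y - b)"] by linarith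
    then show ?thesis
      by (simp add: absval_mult dist_eq_absval[of x a] dist_eq_absval[of y b]
          dist_eq_absval[of "x * y"])
  qed
  ultimately show "LIM x ?F. fst x * snd x :> nhds (a * b)"
    by (intro metric_tendsto_imp_tendsto[where b = "a * b"])
      (auto intro!: always_eventually order_trans[OF _ abs_ge_self])
qed

lemma exists_absval_gt: "\<exists>x::'a::nonarch_local_field. absval x > r"
proof -
  obtain x :: 'a where x: "x \<noteq> 0" "absval x \<noteq> 1"
    using dist_zero_nontrivial by blast
  obtain y :: 'a where y: "absval y > 1"
  proof (cases "absval x > 1")
    case False
    then have "absval (inverse x) > 1"
      using x by (simp add: absval_inverse one_less_inverse_iff)
    then show ?thesis by (rule that)
  qed (use that in blast)
  then obtain n where "r < absval y ^ n"
    using real_arch_pow by blast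
  then show ?thesis
    by (metis absval_power)
qed

lemma exists_absval_lt:
  assumes "e > 0"
  obtains x :: "'a::nonarch_local_field" where "x \<noteq> 0" "absval x < e"
proof -
  obtain x :: 'a where x: "absval x > inverse e"
    using exists_absval_gt by blast
  have e: "0 < inverse e"
    using assms by simp
  then have "x \<noteq> 0"
    using x by force
  moreover have "inverse (absval x) < e"
    using less_imp_inverse_less[OF x e] by simp
  ultimately show ?thesis
    using that[of "inverse x"] by (simp add: absval_inverse)
qed

lemma compact_cball_field: "compact (cball (0::'a::nonarch_local_field) R)"
proof -
  obtain U K where K: "open U" "compact K" "(0::'a) \<in> U" "U \<subseteq> K"
    using locally_compact_field by blast
  then obtain e where e: "e > 0" "ball 0 e \<subseteq> K"
    by (meson open_contains_ball order_trans)
  obtain c :: 'a where c: "absval c > max 0 (R / e)"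
    using exists_absval_gt by blast
  then have c0: "c \<noteq> 0" by auto
  have "cball 0 R \<subseteq> (*) c ` K"
  proof
    fix x assume x: "x \<in> cball (0::'a) R"
    have "absval x \<le> R"
      using x by (simp add: dist_commute)
    then have "absval (inverse c * x) \<le> inverse (absval c) * R"
      by (simp add: absval_mult absval_inverse mult_left_mono)
    also have "\<dots> < e"
      using c c0 e by (simp add: field_simps)
    finally have "inverse c * x \<in> K"
      using e by (auto simp: dist_commute)
    moreover have "x = c * (inverse c * x)"
      using c0 by simp
    ultimately show "x \<in> (*) c ` K" by blast
  qed
  moreover have "compact ((*) c ` K)"
    by (rule compact_continuous_image[OF _ K(2)]) (intro continuous_intros)
  ultimately show ?thesis
    using compact_Int_closed[OF _ closed_cball, of "(*) c ` K" 0 R] by (simp add: inf.absorb2)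
qed

lemma ball_eq_ball:
  assumes "(y::'a::nonarch_local_field) \<in> ball x r"
  shows "ball y r = ball x r"
proof -
  have sub: "ball v r \<subseteq> ball u r" if "v \<in> ball u r" for u v :: 'a
  proof
    fix z assume z: "z \<in> ball v r"
    have "absval ((u - v) + (v - z)) \<le> max (absval (u - v)) (absval (v - z))"
      by (rule dist_zero_ultrametric)
    then show "z \<in> ball u r"
      using that z by (simp add: dist_eq_absval[of u v] dist_eq_absval[of v z] dist_eq_absval[of u z])
  qed
  moreover have "x \<in> ball y r"
    using assms by (simp add: dist_commute)
  ultimately show ?thesis
    using assms by (metis subset_antisym)
qed

lemma closed_ball_field: "closed (ball (x::'a::nonarch_local_field) r)"
proof -
  have "- ball x r = (\<Union>y \<in> - ball x r. ball y r)" if r: "r > 0"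
  proof -
    have "ball y r \<subseteq> - ball x r" if "y \<in> - ball x r" for y
    proof
      fix z assume z: "z \<in> ball y r"
      show "z \<in> - ball x r"
      proof
        assume "z \<in> ball x r"
        then have "ball y r = ball x r"
          using z ball_eq_ball by metis
        then show False
          using that r centre_in_ball[of y r] by simp
      qed
    qed
    moreover have "y \<in> ball y r" for y
      using r by simp
    ultimately show ?thesis by blast
  qed
  then have "open (- ball x r)" if "r > 0"
    using that by (metis open_UN open_ball)
  then show ?thesis
    by (cases "r > 0") (auto simp: closed_def ball_empty)
qed

lemma translate_ball: "(\<lambda>t. x + t) ` ball y r = ball (x + y) r" for x :: "'a::nonarch_local_field"
proof -
  have "t \<in> (\<lambda>t. x + t) ` ball y r" if "t \<in> ball (x + y) r" for t
    using that dist_translate[of y x "t - x"]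
    by (intro image_eqI[of _ _ "t - x"])
      (auto simp: algebra_simps dist_eq_absval[of y] dist_eq_absval[of "x + y"])
  moreover have "x + t \<in> ball (x + y) r" if "t \<in> ball y r" for t
    using that dist_translate[of y x t] by (simp add: add.commute)
  ultimately show ?thesis by auto
qed

section \<open>Harmonic analysis on the field\<close>

definition schwartz :: "('a::nonarch_local_field \<Rightarrow> complex) \<Rightarrow> bool" where
  "schwartz \<phi> \<longleftrightarrow> (\<exists>\<delta>>0. \<forall>t s. absval s < \<delta> \<longrightarrow> \<phi> (t + s) = \<phi> t) \<and>
     (\<exists>R. \<forall>t. \<phi> t \<noteq> 0 \<longrightarrow> absval t \<le> R)"

lemma schwartz_const_on_ball:
  assumes "\<And>t s. absval s < \<delta> \<Longrightarrow> \<phi> (t + s) = \<phi> t" "y \<in> ball x \<delta>"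
  shows "\<phi> y = \<phi> (x :: 'a::nonarch_local_field)"
  using assms(1)[of "y - x" x] assms(2) by (simp add: dist_commute[of x] dist_eq_absval[of y x])

lemma schwartz_locally_constant:
  assumes "schwartz \<phi>"
  shows "locally_constant \<phi>"
proof -
  obtain \<delta> where \<delta>: "\<delta> > 0" "\<And>t s. absval s < \<delta> \<Longrightarrow> \<phi> (t + s) = \<phi> t"
    using assms unfolding schwartz_def by blast
  have "\<phi> constant_on ball x \<delta>" for x
    unfolding constant_on_def using schwartz_const_on_ball[of \<delta> \<phi>, OF \<delta>(2)] by blast
  then show ?thesis
    unfolding locally_constant_def using \<delta>(1) centre_in_ball open_ball by blast
qed

lemma schwartz_compactly_supported:
  assumes "schwartz \<phi>"
  shows "compactly_supported \<phi>"
proof -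
  obtain R where R: "\<And>t. \<phi> t \<noteq> 0 \<Longrightarrow> absval t \<le> R"
    using assms unfolding schwartz_def by blast
  then have "closure {t. \<phi> t \<noteq> 0} \<subseteq> cball 0 R"
    by (intro closure_minimal) (auto simp: dist_commute)
  then show ?thesis
    unfolding compactly_supported_def
    using compact_Int_closed[OF compact_cball_field closed_closure] by (metis inf.absorb2)
qed

lemma schwartz_diff:
  assumes "schwartz \<phi>" "schwartz \<eta>"
  shows "schwartz (\<lambda>t. \<phi> t - \<eta> t)"
proof -
  obtain d e R S where
    "d > 0" "\<And>t s. absval s < d \<Longrightarrow> \<phi> (t + s) = \<phi> t" "\<And>t. \<phi> t \<noteq> 0 \<Longrightarrow> absval t \<le> R"
    "e > 0" "\<And>t s. absval s < e \<Longrightarrow> \<eta> (t + s) = \<eta> t" "\<And>t. \<eta> t \<noteq> 0 \<Longrightarrow> absval t \<le> S"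
    using assms unfolding schwartz_def by metis
  then have "min d e > 0 \<and> (\<forall>t s. absval s < min d e \<longrightarrow> \<phi> (t + s) - \<eta> (t + s) = \<phi> t - \<eta> t)"
    "\<forall>t. \<phi> t - \<eta> t \<noteq> 0 \<longrightarrow> absval t \<le> max R S"
    by (simp_all add: le_max_iff_disj) (metis diff_self)
  then show ?thesis
    unfolding schwartz_def by blast
qed

lemma schwartz_sum_indicators:
  fixes \<phi> :: "'a::nonarch_local_field \<Rightarrow> complex"
  assumes "schwartz \<phi>"
  obtains r I where "r > 0" "finite I"
    "\<And>t. \<phi> t = (\<Sum>i\<in>I. indicator (ball i r) t *\<^sub>R \<phi> i)"
proof -
  obtain r R where r: "r > 0" "\<And>t s. absval s < r \<Longrightarrow> \<phi> (t + s) = \<phi> t"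
    and R: "\<And>t. \<phi> t \<noteq> 0 \<Longrightarrow> absval t \<le> R"
    using assms unfolding schwartz_def by metis
  have const: "\<phi> y = \<phi> x" if "y \<in> ball x r" for x y
    using schwartz_const_on_ball[OF r(2) that] .
  obtain D where D: "finite D" "cball (0::'a) R \<subseteq> (\<Union>x\<in>D. ball x r)"
    using compact_cball_field[of R] r(1) unfolding compact_eq_totally_bounded by blast
  obtain I where I: "I \<subseteq> D" "inj_on (\<lambda>x. ball x r) I" "(\<lambda>x. ball x r) ` D = (\<lambda>x. ball x r) ` I"
    using iffD1[OF subset_image_inj, OF subset_refl] by metis
  have fin: "finite I"
    using I(1) D(1) finite_subset by blast
  have "\<phi> t = (\<Sum>i\<in>I. indicator (ball i r) t *\<^sub>R \<phi> i)" for t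
  proof (cases "\<phi> t = 0")
    case True
    then have "indicator (ball i r) t *\<^sub>R \<phi> i = 0" for i
      using const[of t i] by (auto simp: indicator_def)
    then show ?thesis
      by (simp only: True sum.neutral_const)
  next
    case False
    then have "t \<in> cball 0 R"
      using R[of t] by (simp add: dist_commute)
    then have "t \<in> \<Union>((\<lambda>x. ball x r) ` I)"
      unfolding I(3)[symmetric] using D(2) by (rule subsetD[rotated])
    then obtain i where i: "i \<in> I" "t \<in> ball i r"
      by blast
    have "j = i" if "j \<in> I" "t \<in> ball j r" for j
      using that i I(2) ball_eq_ball[of t] by (metis inj_onD)
    then have zero: "indicator (ball j r) t *\<^sub>R \<phi> j = 0" if "j \<in> I - {i}" for j
      using that by (cases "t \<in> ball j r") auto
    have "(\<Sum>j\<in>I. indicator (ball j r) t *\<^sub>R \<phi> j) = (\<Sum>j\<in>{i}. indicator (ball j r) t *\<^sub>R \<phi> j)"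
      using fin i(1) zero by (intro sum.mono_neutral_right) blast+
    also have "\<dots> = \<phi> t"
      unfolding sum.insert[OF finite.emptyI empty_iff[THEN iffD1, THEN notI]] sum.empty
      using const[OF i(2)] i(2) by (simp del: mem_ball)
    finally show ?thesis ..
  qed
  then show ?thesis
    using that r(1) fin by blast
qed

subsection \<open>Haar measures\<close>

lemma haar_sets [measurable_cong]: "haar_measure \<mu> \<Longrightarrow> sets \<mu> = sets borel"
  by (simp add: haar_measure_def)

lemma haar_space: "haar_measure \<mu> \<Longrightarrow> space \<mu> = UNIV"
  using sets_eq_imp_space_eq[OF haar_sets] by simp

lemma haar_ball_translate:
  assumes "haar_measure \<mu>"
  shows "emeasure \<mu> (ball x r) = emeasure \<mu> (ball 0 r)"
proof -
  have "emeasure \<mu> ((\<lambda>t. x + t) ` ball 0 r) = emeasure \<mu> (ball 0 r)"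
    using assms by (auto simp: haar_measure_def)
  then show ?thesis
    using translate_ball[of x 0 r] by simp
qed

lemma haar_ball_finite:
  assumes "haar_measure \<mu>"
  shows "emeasure \<mu> (ball x r) < \<infinity>"
proof -
  have "emeasure \<mu> (ball 0 r) \<le> emeasure \<mu> (cball 0 r)"
    using assms by (intro emeasure_mono) (auto simp: haar_sets)
  also have "\<dots> < \<infinity>"
    using assms compact_cball_field[of r] unfolding haar_measure_def by blast
  finally show ?thesis
    using haar_ball_translate[OF assms, of x r] by simp
qed

lemma haar_ball_pos:
  assumes "haar_measure \<mu>" "r > 0"
  shows "measure \<mu> (ball x r) > 0"
proof -
  have "emeasure \<mu> (ball 0 r) \<noteq> 0"
  proof
    assume "emeasure \<mu> (ball 0 r) = 0"
    then have null: "ball x r \<in> null_sets \<mu>" for x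
      using haar_ball_translate[OF assms(1), of x r]
      by (auto simp: null_sets_def haar_sets[OF assms(1)])
    have "cball 0 (real n) \<in> null_sets \<mu>" for n
    proof -
      obtain D where D: "finite D" "cball (0::'a) (real n) \<subseteq> (\<Union>x\<in>D. ball x r)"
        using compact_cball_field[of "real n"] assms(2)
        unfolding compact_eq_totally_bounded by blast
      have "(\<Union>x\<in>D. ball x r) \<in> null_sets \<mu>"
        using null D(1) by (intro null_sets_UN') (auto simp: countable_finite)
      then show ?thesis
        by (rule null_sets_subset) (simp_all add: D(2) haar_sets[OF assms(1)])
    qed
    then have "(\<Union>n. cball 0 (real n)) \<in> null_sets \<mu>"
      by (rule null_sets_UN)
    moreover have "x \<in> (\<Union>n. cball 0 (real n))" for x :: 'a
      using real_arch_simple[of "dist 0 x"] by simp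
    then have "(\<Union>n. cball 0 (real n)) = (UNIV :: 'a set)"
      by blast
    ultimately show False
      using assms(1) by (auto simp: haar_measure_def null_sets_def)
  qed
  then show ?thesis
    using haar_ball_finite[OF assms(1), of x r] haar_ball_translate[OF assms(1), of x r]
    by (simp add: measure_def enn2real_positive_iff less_top zero_less_iff_neq_zero)
qed

lemma schwartz_integral:
  assumes "schwartz \<phi>"
  obtains c r where "r > 0" "\<And>\<mu>. haar_measure \<mu> \<Longrightarrow> integrable \<mu> \<phi>"
    "\<And>\<mu>. haar_measure \<mu> \<Longrightarrow> (\<integral>t. \<phi> t \<partial>\<mu>) = c * complex_of_real (measure \<mu> (ball 0 r))"
proof -
  obtain r I where rI: "r > 0" "finite I"
    and \<phi>: "\<And>t. \<phi> t = (\<Sum>i\<in>I. indicator (ball i r) t *\<^sub>R \<phi> i)"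
    using schwartz_sum_indicators[OF assms] by blast
  have int: "has_bochner_integral \<mu> \<phi> ((\<Sum>i\<in>I. \<phi> i) * complex_of_real (measure \<mu> (ball 0 r)))"
    if \<mu>: "haar_measure \<mu>" for \<mu>
  proof -
    have "has_bochner_integral \<mu> (\<lambda>t. \<Sum>i\<in>I. indicator (ball i r) t *\<^sub>R \<phi> i)
        (\<Sum>i\<in>I. measure \<mu> (ball i r) *\<^sub>R \<phi> i)"
      by (intro has_bochner_integral_sum has_bochner_integral_indicator haar_ball_finite \<mu>)
        (simp add: haar_sets[OF \<mu>])
    moreover have "measure \<mu> (ball i r) = measure \<mu> (ball 0 r)" for i
      using haar_ball_translate[OF \<mu>, of i r] by (simp add: measure_def)
    then have "(\<Sum>i\<in>I. measure \<mu> (ball i r) *\<^sub>R \<phi> i) =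
        (\<Sum>i\<in>I. \<phi> i) * complex_of_real (measure \<mu> (ball 0 r))"
      by (subst sum_distrib_right) (intro sum.cong, simp_all add: scaleR_conv_of_real)
    ultimately show ?thesis
      unfolding \<phi>[symmetric] by simp
  qed
  show ?thesis
    using that[OF rI(1)] int unfolding has_bochner_integral_iff by blast
qed

lemma schwartz_integrable: "schwartz \<phi> \<Longrightarrow> haar_measure \<mu> \<Longrightarrow> integrable \<mu> \<phi>"
  using schwartz_integral by metis

text \<open>This replaces the uniqueness of Haar measure.\<close>

lemma schwartz_integral_eq_0:
  assumes "schwartz \<phi>" "haar_measure \<mu>" "haar_measure \<nu>" "(\<integral>t. \<phi> t \<partial>\<mu>) = 0"
  shows "(\<integral>t. \<phi> t \<partial>\<nu>) = 0"
proof -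
  obtain c r where r: "r > 0"
    and c: "\<And>\<mu>. haar_measure \<mu> \<Longrightarrow> (\<integral>t. \<phi> t \<partial>\<mu>) = c * complex_of_real (measure \<mu> (ball 0 r))"
    using schwartz_integral[OF assms(1)] by metis
  have "c = 0"
    using c[OF assms(2)] assms(4) haar_ball_pos[OF assms(2) r, of 0] by auto
  then show ?thesis
    using c[OF assms(3)] by simp
qed

lemma haar_measure_scale:
  assumes "haar_measure \<mu>" "a \<noteq> 0"
  shows "haar_measure (distr \<mu> borel (\<lambda>t. a * t))"
proof -
  have meas [measurable]: "(\<lambda>t. a * t) \<in> \<mu> \<rightarrow>\<^sub>M borel"
  proof -
    have "(\<lambda>t. a * t) \<in> borel_measurable borel"
      by (intro borel_measurable_continuous_onI continuous_intros)
    then show ?thesis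
      using measurable_cong_sets[OF haar_sets[OF assms(1)] refl] by blast
  qed
  have em: "emeasure (distr \<mu> borel (\<lambda>t. a * t)) A = emeasure \<mu> ((\<lambda>t. a * t) -` A)"
    if "A \<in> sets borel" for A
    using that by (simp add: emeasure_distr haar_space[OF assms(1)])
  have vim: "(\<lambda>t. a * t) -` A \<in> sets borel" if "A \<in> sets borel" for A
    using measurable_sets[OF meas that] by (simp add: haar_space[OF assms(1)] haar_sets[OF assms(1)])
  show ?thesis
    unfolding haar_measure_def
  proof (intro conjI ballI allI impI)
    fix A :: "'a set" and x assume A: "A \<in> sets borel"
    have "(\<lambda>t. x + t) ` A = (\<lambda>t. t - x) -` A"
      by (force simp: image_iff)
    moreover have "(\<lambda>t. t - x) \<in> borel_measurable borel"
      by (intro borel_measurable_continuous_onI continuous_intros)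
    ultimately have A': "(\<lambda>t. x + t) ` A \<in> sets borel"
      using A measurable_sets_borel by metis
    have "(\<lambda>t. a * t) -` ((\<lambda>t. x + t) ` A) = (\<lambda>t. inverse a * x + t) ` ((\<lambda>t. a * t) -` A)"
    proof (intro equalityI subsetI)
      fix t assume "t \<in> (\<lambda>t. a * t) -` ((\<lambda>t. x + t) ` A)"
      then obtain s where "s \<in> A" "a * t = x + s"
        by auto
      then have "a * (t - inverse a * x) = s"
        using assms(2) by (simp add: algebra_simps)
      then show "t \<in> (\<lambda>t. inverse a * x + t) ` ((\<lambda>t. a * t) -` A)"
        using \<open>s \<in> A\<close> by (intro image_eqI[of _ _ "t - inverse a * x"]) simp_all
    next
      fix t assume "t \<in> (\<lambda>t. inverse a * x + t) ` ((\<lambda>t. a * t) -` A)"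
      then obtain s where "a * s \<in> A" "t = inverse a * x + s"
        by auto
      then show "t \<in> (\<lambda>t. a * t) -` ((\<lambda>t. x + t) ` A)"
        using assms(2) by (simp add: distrib_left mult.assoc[symmetric])
    qed
    then show "emeasure (distr \<mu> borel (\<lambda>t. a * t)) ((\<lambda>t. x + t) ` A) =
        emeasure (distr \<mu> borel (\<lambda>t. a * t)) A"
      using em[OF A] em[OF A'] vim[OF A] assms(1) by (simp add: haar_measure_def)
  next
    fix K :: "'a set" assume K: "compact K"
    have "(\<lambda>t. a * t) -` K = (\<lambda>t. inverse a * t) ` K"
    proof (intro equalityI subsetI)
      fix t assume "t \<in> (\<lambda>t. a * t) -` K"
      then show "t \<in> (\<lambda>t. inverse a * t) ` K"
        using assms(2) by (intro image_eqI[of _ _ "a * t"]) simp_all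
    qed (use assms(2) in \<open>auto simp: mult.assoc[symmetric]\<close>)
    moreover have "compact ((\<lambda>t. inverse a * t) ` K)"
      by (rule compact_continuous_image[OF _ K]) (intro continuous_intros)
    ultimately show "emeasure (distr \<mu> borel (\<lambda>t. a * t)) K < \<infinity>"
      using assms(1) em[of K] compact_imp_closed[OF K] by (simp add: haar_measure_def)
  next
    show "emeasure (distr \<mu> borel (\<lambda>t. a * t)) UNIV \<noteq> 0"
      using assms(1) em[of UNIV] by (simp add: haar_measure_def)
  qed simp
qed

lemma haar_integral_translate:
  fixes \<phi> :: "'a::nonarch_local_field \<Rightarrow> complex"
  assumes "haar_measure \<mu>" "integrable \<mu> \<phi>"
  shows "(\<integral>t. \<phi> (x + t) \<partial>\<mu>) = (\<integral>t. \<phi> t \<partial>\<mu>)"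
proof -
  have meas: "(\<lambda>t. x + t) \<in> \<mu> \<rightarrow>\<^sub>M \<mu>"
  proof -
    have "(\<lambda>t. x + t) \<in> borel_measurable borel"
      by (intro borel_measurable_continuous_onI continuous_intros)
    then show ?thesis
      using measurable_cong_sets[OF haar_sets[OF assms(1)] haar_sets[OF assms(1)]] by blast
  qed
  have "distr \<mu> \<mu> (\<lambda>t. x + t) = \<mu>"
  proof (rule measure_eqI)
    fix A assume "A \<in> sets (distr \<mu> \<mu> (\<lambda>t. x + t))"
    then have A: "A \<in> sets \<mu>" by simp
    have "emeasure (distr \<mu> \<mu> (\<lambda>t. x + t)) A = emeasure \<mu> ((\<lambda>t. x + t) -` A)"
      using A by (simp add: emeasure_distr[OF meas] haar_space[OF assms(1)])
    also have "(\<lambda>t. x + t) -` A = (\<lambda>t. - x + t) ` A"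
      by (force simp: image_iff)
    also have "emeasure \<mu> ((\<lambda>t. - x + t) ` A) = emeasure \<mu> A"
      using A assms(1) unfolding haar_measure_def by blast
    finally show "emeasure (distr \<mu> \<mu> (\<lambda>t. x + t)) A = emeasure \<mu> A" .
  qed simp
  then show ?thesis
    using integral_distr[OF meas borel_measurable_integrable[OF assms(2)]] by simp
qed

subsection \<open>Smooth characters\<close>

context
  fixes \<psi> :: "'a::nonarch_local_field \<Rightarrow> complex"
  assumes \<psi>: "smooth_character \<psi>"
begin

lemma character_add: "\<psi> (x + y) = \<psi> x * \<psi> y"
  using \<psi> by (simp add: smooth_character_def)

lemma character_nonzero [simp]: "\<psi> x \<noteq> 0"
  using \<psi> by (simp add: smooth_character_def)

lemma character_0 [simp]: "\<psi> 0 = 1"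
  using character_add[of 0 0] character_nonzero[of 0] by simp

lemma character_minus: "\<psi> (- x) = inverse (\<psi> x)"
  using character_add[of x "- x"] inverse_unique[of "\<psi> x" "\<psi> (- x)"] by simp

lemma character_trivial_near_0:
  obtains \<delta> where "\<delta> > 0" "\<And>x. absval x < \<delta> \<Longrightarrow> \<psi> x = 1"
proof -
  obtain V where V: "open V" "0 \<in> V" "\<psi> constant_on V"
    using \<psi> unfolding smooth_character_def locally_constant_def by blast
  then obtain \<delta> where \<delta>: "\<delta> > 0" "ball 0 \<delta> \<subseteq> V"
    by (meson open_contains_ball)
  have "\<psi> x = 1" if "absval x < \<delta>" for x
  proof -
    have "x \<in> V"
      using that \<delta>(2) by (auto simp: dist_commute)
    then show ?thesis
      using V(2,3) character_0 unfolding constant_on_def by metis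
  qed
  then show ?thesis
    using that \<delta>(1) by blast
qed

lemma continuous_on_character: "continuous_on S \<psi>"
proof -
  obtain \<delta> where \<delta>: "\<delta> > 0" "\<And>x. absval x < \<delta> \<Longrightarrow> \<psi> x = 1"
    using character_trivial_near_0 by blast
  have "\<psi> y = \<psi> x" if "dist y x < \<delta>" for x y
    using character_add[of x "y - x"] \<delta>(2)[of "y - x"] that by (simp add: dist_eq_absval[of y])
  then show ?thesis
    unfolding continuous_on_iff using \<delta>(1) by (metis dist_self)
qed

text \<open>The multiples of \<open>x\<close> stay in a compact ball, so the powers of \<open>\<psi> x\<close> are bounded.\<close>

lemma norm_character: "norm (\<psi> x) = 1"
proof -
  have le: "norm (\<psi> x) \<le> 1" for x
  proof (rule ccontr)
    assume gt: "\<not> norm (\<psi> x) \<le> 1"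
    have "compact (\<psi> ` cball 0 (absval x))"
      by (intro compact_continuous_image continuous_on_character compact_cball_field)
    then obtain B where B: "\<And>y. y \<in> cball 0 (absval x) \<Longrightarrow> norm (\<psi> y) \<le> B"
      by (meson bounded_iff compact_imp_bounded imageI)
    have mult: "absval (of_nat n * x) \<le> absval x" for n
    proof (induction n)
      case (Suc n)
      then show ?case
        using dist_zero_ultrametric[of x "of_nat n * x"] by (simp add: distrib_right)
    qed simp
    have "\<psi> (of_nat n * x) = \<psi> x ^ n" for n
      by (induction n) (simp_all add: distrib_right character_add)
    then have "norm (\<psi> x) ^ n \<le> B" for n
      using B[of "of_nat n * x"] mult[of n] by (simp add: dist_commute norm_power)
    moreover obtain n where "B < norm (\<psi> x) ^ n"
      using real_arch_pow gt by (metis not_le)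
    ultimately show False
      by (simp add: not_le[symmetric])
  qed
  have "inverse (norm (\<psi> x)) \<le> 1"
    using le[of "- x"] by (simp add: character_minus norm_inverse)
  then have "1 \<le> norm (\<psi> x)"
    using character_nonzero[of x] by (simp add: inverse_le_1_iff)
  then show ?thesis
    using le[of x] by simp
qed

lemma cnj_character: "cnj (\<psi> x) = \<psi> (- x)"
  using norm_character[of x] complex_norm_square[of "\<psi> x"] inverse_unique[of "\<psi> x" "cnj (\<psi> x)"]
  by (simp add: character_minus)

lemma schwartz_mult_character:
  assumes "schwartz \<phi>"
  shows "schwartz (\<lambda>t. \<phi> t * \<psi> (b * t))"
proof -
  obtain r R where r: "r > 0" "\<And>t s. absval s < r \<Longrightarrow> \<phi> (t + s) = \<phi> t"
    and R: "\<And>t. \<phi> t \<noteq> 0 \<Longrightarrow> absval t \<le> R"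
    using assms unfolding schwartz_def by metis
  obtain \<delta> where \<delta>: "\<delta> > 0" "\<And>x. absval x < \<delta> \<Longrightarrow> \<psi> x = 1"
    using character_trivial_near_0 by blast
  define e where "e = min r (\<delta> / (absval b + 1))"
  have b: "absval b + 1 > 0"
    using zero_le_dist[of b 0] by linarith
  have e: "e > 0"
    using r(1) \<delta>(1) b by (simp add: e_def)
  have "\<psi> (b * s) = 1" if "absval s < e" for s
  proof (rule \<delta>(2))
    have "absval b * absval s \<le> (absval b + 1) * absval s"
      by (intro mult_right_mono) simp_all
    also have "\<dots> < \<delta>"
      using that b by (simp add: e_def pos_less_divide_eq mult.commute)
    finally show "absval (b * s) < \<delta>"
      by (simp add: absval_mult)
  qed
  then have "\<forall>t s. absval s < e \<longrightarrow> \<phi> (t + s) * \<psi> (b * (t + s)) = \<phi> t * \<psi> (b * t)"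
    using r(2) by (simp add: distrib_left character_add e_def)
  moreover have "\<forall>t. \<phi> t * \<psi> (b * t) \<noteq> 0 \<longrightarrow> absval t \<le> R"
    using R by simp
  ultimately show ?thesis
    unfolding schwartz_def using e by blast
qed

subsection \<open>Injectivity of the Fourier transform\<close>

inductive trig_poly :: "('a \<Rightarrow> complex) \<Rightarrow> bool" where
  character: "trig_poly (\<lambda>t. \<psi> (b * t))"
| add: "trig_poly f \<Longrightarrow> trig_poly g \<Longrightarrow> trig_poly (\<lambda>t. f t + g t)"
| scale: "trig_poly f \<Longrightarrow> trig_poly (\<lambda>t. c * f t)"

lemma trig_poly_mult:
  assumes "trig_poly f" "trig_poly g"
  shows "trig_poly (\<lambda>t. f t * g t)"
  using assms(1)
proof induction
  case (character b)
  show ?case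
    using assms(2)
  proof induction
    case (character b')
    have "(\<lambda>t. \<psi> (b * t) * \<psi> (b' * t)) = (\<lambda>t. \<psi> ((b + b') * t))"
      by (simp add: distrib_right character_add)
    then show ?case
      using trig_poly.character by metis
  next
    case (add f g)
    then show ?case
      using trig_poly.add by (fastforce simp: distrib_left)
  next
    case (scale f c)
    then show ?case
      using trig_poly.scale[OF scale.IH, of c] by (simp add: mult.left_commute)
  qed
next
  case (add f g)
  then show ?case
    using trig_poly.add by (fastforce simp: distrib_right)
next
  case (scale f c)
  then show ?case
    using trig_poly.scale[OF scale.IH, of c] by (simp add: mult.assoc)
qed

lemma trig_poly_cnj: "trig_poly f \<Longrightarrow> trig_poly (\<lambda>t. cnj (f t))"
proof (induction rule: trig_poly.induct)
  case (character b)
  show ?case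
    using trig_poly.character[of "- b"] by (simp add: cnj_character)
next
  case (add f g)
  then show ?case
    using trig_poly.add by fastforce
next
  case (scale f c)
  then show ?case
    using trig_poly.scale[OF scale.IH, of "cnj c"] by simp
qed

lemma trig_poly_const: "trig_poly (\<lambda>t. c)"
  using trig_poly.scale[OF trig_poly.character[of 0], of c] by simp

lemma trig_poly_Re:
  assumes "trig_poly f"
  shows "trig_poly (\<lambda>t. complex_of_real (Re (f t)))"
proof -
  have "(\<lambda>t. complex_of_real (Re (f t))) = (\<lambda>t. 1/2 * (f t + cnj (f t)))"
    by (simp add: complex_add_cnj)
  then show ?thesis
    using trig_poly.scale[OF trig_poly.add[OF assms trig_poly_cnj[OF assms]], of "1/2"]
    by (simp only:)
qed

lemma trig_poly_Im:
  assumes "trig_poly f"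
  shows "trig_poly (\<lambda>t. complex_of_real (Im (f t)))"
  using trig_poly_Re[OF trig_poly.scale[OF assms, of "- \<i>"]] by simp

lemma continuous_on_trig_poly: "trig_poly f \<Longrightarrow> continuous_on S f"
proof (induction rule: trig_poly.induct)
  case (character b)
  show ?case
    by (rule continuous_on_compose2[OF continuous_on_character[of UNIV]])
      (auto intro!: continuous_intros)
qed (auto intro!: continuous_intros)

lemma trig_poly_integral_0:
  assumes "schwartz \<phi>" "haar_measure \<mu>" "\<And>b. (\<integral>t. \<phi> t * \<psi> (b * t) \<partial>\<mu>) = 0" "trig_poly f"
  shows "integrable \<mu> (\<lambda>t. \<phi> t * f t) \<and> (\<integral>t. \<phi> t * f t \<partial>\<mu>) = 0"
  using assms(4)
proof induction
  case (character b)
  show ?case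
    using assms schwartz_integrable[OF schwartz_mult_character[OF assms(1)] assms(2)] by simp
next
  case (add f g)
  then show ?case
    by (simp add: distrib_left)
next
  case (scale f c)
  have "(\<lambda>t. \<phi> t * (c * f t)) = (\<lambda>t. c * (\<phi> t * f t))"
    by (simp add: mult.left_commute)
  then show ?case
    using scale by simp
qed

lemma trig_poly_approx:
  assumes "\<exists>x. \<psi> x \<noteq> 1" "compact S" "continuous_on S h" "e > 0"
  obtains p :: "'a \<Rightarrow> real"
  where "trig_poly (\<lambda>t. complex_of_real (p t))" "\<And>t. t \<in> S \<Longrightarrow> \<bar>h t - p t\<bar> < e"
proof -
  interpret function_ring_on "{p. trig_poly (\<lambda>t. complex_of_real (p t))}" S
  proof
    fix f assume "f \<in> {p. trig_poly (\<lambda>t. complex_of_real (p t))}"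
    then have "continuous_on S (\<lambda>t. Re (complex_of_real (f t)))"
      using continuous_on_trig_poly by (intro continuous_on_Re) blast
    then show "continuous_on S f" by simp
  next
    fix x y :: 'a assume "x \<noteq> y"
    obtain z where z: "\<psi> z \<noteq> 1"
      using assms(1) by blast
    define b where "b = z / (x - y)"
    have "b * x = b * y + z"
      using \<open>x \<noteq> y\<close> by (simp add: b_def divide_simps) (simp add: algebra_simps)
    then have "\<psi> (b * x) \<noteq> \<psi> (b * y)"
      using z by (simp add: character_add)
    then have "Re (\<psi> (b * x)) \<noteq> Re (\<psi> (b * y)) \<or> Im (\<psi> (b * x)) \<noteq> Im (\<psi> (b * y))"
      by (simp add: complex_eq_iff)
    then show "\<exists>f\<in>{p. trig_poly (\<lambda>t. complex_of_real (p t))}. f x \<noteq> f y"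
      using trig_poly_Re[OF trig_poly.character[of b]] trig_poly_Im[OF trig_poly.character[of b]]
      by auto
  qed (use assms(2) trig_poly.add trig_poly_mult trig_poly_const in \<open>auto\<close>)
  show ?thesis
    using Stone_Weierstrass_basic[OF assms(3,4)] that by auto
qed

lemma schwartz_eq_0_if_orthogonal:
  assumes \<phi>: "schwartz \<phi>" and \<mu>: "haar_measure \<mu>"
    and 0: "\<And>b. (\<integral>t. \<phi> t * \<psi> (b * t) \<partial>\<mu>) = 0" and nontrivial: "\<exists>x. \<psi> x \<noteq> 1"
  shows "\<phi> x = 0"
proof -
  obtain r R where r: "r > 0" "\<And>t s. absval s < r \<Longrightarrow> \<phi> (t + s) = \<phi> t"
    and R: "\<And>t. \<phi> t \<noteq> 0 \<Longrightarrow> absval t \<le> R"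
    using \<phi> unfolding schwartz_def by metis
  have const: "\<phi> t = \<phi> x" if "t \<in> ball x r" for t
    using schwartz_const_on_ball[OF r(2) that] .
  have int: "integrable \<mu> \<phi>"
    using schwartz_integrable[OF \<phi> \<mu>] .
  define h :: "'a \<Rightarrow> real" where "h = indicator (ball x r)"
  have "closed (- ball x r)" "closed (ball x r)"
    using closed_ball_field by (auto simp: closed_Compl)
  then have cont: "continuous_on UNIV h"
    using continuous_on_cases[of "ball x r" "- ball x r" "\<lambda>_. 1::real" "\<lambda>_. 0" "\<lambda>t. t \<in> ball x r"]
    by (simp add: h_def indicator_def[abs_def] of_bool_def)
  have int_h: "integrable \<mu> (\<lambda>t. h t *\<^sub>R \<phi> t)"
    unfolding h_def by (intro integrable_mult_indicator int) (simp add: haar_sets[OF \<mu>])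
  have "norm (\<integral>t. h t *\<^sub>R \<phi> t \<partial>\<mu>) \<le> e * (\<integral>t. norm (\<phi> t) \<partial>\<mu>)" if e: "e > 0" for e
  proof -
    obtain p where p: "trig_poly (\<lambda>t. complex_of_real (p t))"
      "\<And>t. t \<in> cball 0 R \<Longrightarrow> \<bar>h t - p t\<bar> < e"
      using trig_poly_approx[OF nontrivial compact_cball_field continuous_on_subset[OF cont] e] by blast
    have p0: "integrable \<mu> (\<lambda>t. \<phi> t * complex_of_real (p t))"
      "(\<integral>t. \<phi> t * complex_of_real (p t) \<partial>\<mu>) = 0"
      using trig_poly_integral_0[OF \<phi> \<mu> 0 p(1)] by auto
    have "(\<integral>t. h t *\<^sub>R \<phi> t \<partial>\<mu>) = (\<integral>t. h t *\<^sub>R \<phi> t - \<phi> t * complex_of_real (p t) \<partial>\<mu>)"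
      using int_h p0 by simp
    also have "norm \<dots> \<le> (\<integral>t. norm (h t *\<^sub>R \<phi> t - \<phi> t * complex_of_real (p t)) \<partial>\<mu>)"
      by (rule integral_norm_bound)
    also have "\<dots> \<le> (\<integral>t. e * norm (\<phi> t) \<partial>\<mu>)"
    proof (rule integral_mono)
      show "integrable \<mu> (\<lambda>t. norm (h t *\<^sub>R \<phi> t - \<phi> t * complex_of_real (p t)))"
        using int_h p0(1) by (intro integrable_norm Bochner_Integration.integrable_diff)
      show "integrable \<mu> (\<lambda>t. e * norm (\<phi> t))"
        using int by simp
      fix t
      have "h t *\<^sub>R \<phi> t - \<phi> t * complex_of_real (p t) = complex_of_real (h t - p t) * \<phi> t"
        by (simp add: scaleR_conv_of_real algebra_simps)
      then have eq: "norm (h t *\<^sub>R \<phi> t - \<phi> t * complex_of_real (p t)) = \<bar>h t - p t\<bar> * norm (\<phi> t)"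
        by (simp add: norm_mult del: of_real_diff)
      show "norm (h t *\<^sub>R \<phi> t - \<phi> t * complex_of_real (p t)) \<le> e * norm (\<phi> t)"
      proof (cases "\<phi> t = 0")
        case False
        then have "\<bar>h t - p t\<bar> \<le> e"
          using R[of t] p(2)[of t] by (simp add: dist_commute)
        then show ?thesis
          unfolding eq by (rule mult_right_mono) simp
      qed simp
    qed
    finally show ?thesis by simp
  qed
  note bound = this
  have "norm (\<integral>t. h t *\<^sub>R \<phi> t \<partial>\<mu>) \<le> 0"
  proof (rule field_le_epsilon)
    fix d :: real assume d: "d > 0"
    define B where "B = (\<integral>t. norm (\<phi> t) \<partial>\<mu>)"
    have B: "B \<ge> 0"
      by (simp add: B_def)
    have "norm (\<integral>t. h t *\<^sub>R \<phi> t \<partial>\<mu>) \<le> d / (B + 1) * B"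
      unfolding B_def by (rule bound) (use d B in \<open>simp add: B_def[symmetric]\<close>)
    also have "\<dots> \<le> d"
      using d B by (simp add: field_simps)
    finally show "norm (\<integral>t. h t *\<^sub>R \<phi> t \<partial>\<mu>) \<le> 0 + d" by simp
  qed
  then have "(\<integral>t. h t *\<^sub>R \<phi> t \<partial>\<mu>) = 0"
    by simp
  moreover have "(\<lambda>t. h t *\<^sub>R \<phi> t) = (\<lambda>t. indicator (ball x r) t *\<^sub>R \<phi> x)"
    using const by (auto simp: h_def indicator_def fun_eq_iff simp del: mem_ball)
  moreover have "has_bochner_integral \<mu> (\<lambda>t. indicator (ball x r) t *\<^sub>R \<phi> x)
      (measure \<mu> (ball x r) *\<^sub>R \<phi> x)"
    by (intro has_bochner_integral_indicator haar_ball_finite \<mu>) (simp add: haar_sets[OF \<mu>])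
  ultimately have "measure \<mu> (ball x r) *\<^sub>R \<phi> x = 0"
    by (simp add: has_bochner_integral_integral_eq)
  then show ?thesis
    using haar_ball_pos[OF \<mu> r(1), of x] by simp
qed

end

lemma schwartz_eq_0_if_dilates_orthogonal:
  fixes \<phi> :: "'a::nonarch_local_field \<Rightarrow> complex"
  assumes \<psi>: "smooth_character \<psi>" and nontrivial: "\<exists>x. \<psi> x \<noteq> 1"
    and \<phi>: "schwartz \<phi>" and \<mu>: "haar_measure \<mu>"
    and 0: "\<And>a. a \<noteq> 0 \<Longrightarrow> (\<integral>t. \<phi> (a * t) * cnj (\<psi> t) \<partial>\<mu>) = 0"
  shows "\<phi> x = 0"
proof -
  have nonzero: "(\<integral>t. \<phi> t * \<psi> (b * t) \<partial>\<mu>) = 0" if b: "b \<noteq> 0" for b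
  proof -
    define a where "a = - inverse b"
    have a: "a \<noteq> 0" "b * (a * t) = - t" for t
      using b by (simp_all add: a_def mult.assoc[symmetric])
    define \<nu> where "\<nu> = distr \<mu> borel (\<lambda>t. a * t)"
    have \<nu>: "haar_measure \<nu>"
      unfolding \<nu>_def using haar_measure_scale[OF \<mu> a(1)] .
    have sch: "schwartz (\<lambda>t. \<phi> t * \<psi> (b * t))"
      using schwartz_mult_character[OF \<psi> \<phi>] .
    have "(\<lambda>t. a * t) \<in> borel_measurable borel"
      by (intro borel_measurable_continuous_onI continuous_intros)
    then have meas: "(\<lambda>t. a * t) \<in> \<mu> \<rightarrow>\<^sub>M borel"
      using measurable_cong_sets[OF haar_sets[OF \<mu>] refl] by blast
    have "(\<lambda>t. \<phi> t * \<psi> (b * t)) \<in> borel_measurable borel"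
      using borel_measurable_integrable[OF schwartz_integrable[OF sch \<mu>]]
        measurable_cong_sets[OF haar_sets[OF \<mu>] refl] by blast
    then have "(\<integral>t. \<phi> t * \<psi> (b * t) \<partial>\<nu>) = (\<integral>t. \<phi> (a * t) * \<psi> (b * (a * t)) \<partial>\<mu>)"
      unfolding \<nu>_def by (rule integral_distr[OF meas])
    also have "\<dots> = 0"
      using 0[OF a(1)] by (simp add: a(2) cnj_character[OF \<psi>])
    finally show ?thesis
      using schwartz_integral_eq_0[OF sch \<nu> \<mu>] by simp
  qed
  have zero: "(\<integral>t. \<phi> t * \<psi> (0 * t) \<partial>\<mu>) = 0"
  proof -
    obtain \<delta> where \<delta>: "\<delta> > 0" "\<And>x. absval x < \<delta> \<Longrightarrow> \<psi> x = 1"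
      using character_trivial_near_0[OF \<psi>] by blast
    obtain R where R: "\<And>t. \<phi> t \<noteq> 0 \<Longrightarrow> absval t \<le> R"
      using \<phi> unfolding schwartz_def by blast
    have "\<delta> / (\<bar>R\<bar> + 1) > 0"
      using \<delta>(1) by simp
    then obtain b :: 'a where b: "b \<noteq> 0" "absval b < \<delta> / (\<bar>R\<bar> + 1)"
      by (rule exists_absval_lt)
    have "\<psi> (b * t) = 1" if "\<phi> t \<noteq> 0" for t
    proof (rule \<delta>(2))
      have "absval b * absval t \<le> absval b * (\<bar>R\<bar> + 1)"
        using R[OF that] by (intro mult_left_mono) simp_all
      also have "\<dots> < \<delta>"
        using b(2) by (simp add: pos_less_divide_eq)
      finally show "absval (b * t) < \<delta>"
        by (simp add: absval_mult)
    qed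
    then have "\<phi> t * \<psi> (0 * t) = \<phi> t * \<psi> (b * t)" for t
      using character_0[OF \<psi>] by (cases "\<phi> t = 0") simp_all
    then show ?thesis
      using nonzero[OF b(1)] by presburger
  qed
  show ?thesis
    using schwartz_eq_0_if_orthogonal[OF \<psi> \<phi> \<mu> _ nontrivial] zero nonzero by metis
qed

section \<open>The group\<close>

abbreviation mat2 :: "'a \<Rightarrow> 'a \<Rightarrow> 'a \<Rightarrow> 'a \<Rightarrow> 'a::field ^ 2 ^ 2" where
  "mat2 a b c d \<equiv> vector [vector [a, b], vector [c, d]]"

lemma mat2_cases: obtains a b c d where "(A :: 'a::field ^ 2 ^ 2) = mat2 a b c d"
  using that[of "A $ 1 $ 1" "A $ 1 $ 2" "A $ 2 $ 1" "A $ 2 $ 2"]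
  by (simp add: vec_eq_iff forall_2)

lemma mat2_mult:
  "mat2 a b c d ** mat2 a' b' c' d' =
    mat2 (a * a' + b * c') (a * b' + b * d') (c * a' + d * c') (c * b' + d * d')"
  by (simp add: vec_eq_iff matrix_matrix_mult_def forall_2 sum_2)

lemma mat_eq_mat2: "mat c = mat2 c 0 0 c"
  by (simp add: vec_eq_iff mat_def forall_2)

lemma in_GL2_iff: "A \<in> carrier GL2 \<longleftrightarrow> det A \<noteq> 0"
  by (simp add: GL2_def invertible_det_nz)

lemma mat2_in_GL2_iff: "mat2 a b c d \<in> carrier GL2 \<longleftrightarrow> a * d - b * c \<noteq> 0"
  by (simp add: in_GL2_iff det_2)

lemma GL2_mult: "A \<in> carrier GL2 \<Longrightarrow> B \<in> carrier GL2 \<Longrightarrow> A ** B \<in> carrier GL2"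
  by (simp add: in_GL2_iff det_mul)

lemma proj_mult:
  "A \<in> carrier GL2 \<Longrightarrow> B \<in> carrier GL2 \<Longrightarrow> proj A \<otimes>\<^bsub>PGL2\<^esub> proj B = proj (A ** B)"
  using hom_mult[OF proj_hom, of A B] by (simp add: GL2_def)

lemma uni_add: "uni s \<otimes>\<^bsub>PGL2\<^esub> uni t = uni (s + t)"
  unfolding uni_def by (simp add: proj_mult mat2_in_GL2_iff mat2_mult add.commute)

lemma diag_uni:
  assumes "a \<noteq> 0"
  shows "proj (mat2 a 0 0 1) \<otimes>\<^bsub>PGL2\<^esub> uni t = uni (a * t) \<otimes>\<^bsub>PGL2\<^esub> proj (mat2 a 0 0 1)"
  using assms unfolding uni_def by (simp add: proj_mult mat2_in_GL2_iff mat2_mult)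

lemma continuous_on_matrix_mult:
  fixes f g :: "'b::topological_space \<Rightarrow> 'a::nonarch_local_field ^ 2 ^ 2"
  assumes "continuous_on S f" "continuous_on S g"
  shows "continuous_on S (\<lambda>x. f x ** g x)"
  unfolding matrix_matrix_mult_def sum_2 using assms by (intro continuous_intros)

lemma conjugate_uni_in_open:
  fixes K :: "'a::nonarch_local_field pgl2 set"
  assumes "openin PGL2_top K" "\<one>\<^bsub>PGL2\<^esub> \<in> K" "g \<in> carrier PGL2"
  obtains \<delta> where "\<delta> > 0" "\<And>s. absval s < \<delta> \<Longrightarrow> g \<otimes>\<^bsub>PGL2\<^esub> uni s \<otimes>\<^bsub>PGL2\<^esub> inv\<^bsub>PGL2\<^esub> g \<in> K"
proof -
  interpret PGL2: group "PGL2 :: 'a pgl2 monoid" by (rule group_PGL2)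
  obtain A where A: "A \<in> carrier GL2" "g = proj A"
    using assms(3) by (auto simp: carrier_PGL2)
  then obtain B where AB: "A ** B = mat 1" "B ** A = mat 1"
    by (auto simp: GL2_def invertible_def)
  then have B: "B \<in> carrier GL2"
    by (auto simp: GL2_def invertible_def)
  have one: "proj (mat 1) = \<one>\<^bsub>PGL2 :: 'a pgl2 monoid\<^esub>"
    using hom_one[OF proj_hom group_GL2 group_PGL2] by (simp add: GL2_def)
  have inv: "inv\<^bsub>PGL2\<^esub> g = proj B"
    using A B AB(2) one by (intro PGL2.inv_equality) (auto simp: proj_mult carrier_PGL2)
  define M where "M s = A ** mat2 1 s 0 1 ** B" for s
  have conj: "M s \<in> carrier GL2" "g \<otimes>\<^bsub>PGL2\<^esub> uni s \<otimes>\<^bsub>PGL2\<^esub> inv\<^bsub>PGL2\<^esub> g = proj (M s)" for s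
  proof -
    have AU: "A ** mat2 1 s 0 1 \<in> carrier GL2"
      using A(1) uni_matrix_in_GL2 by (rule GL2_mult)
    then show "M s \<in> carrier GL2"
      unfolding M_def using B by (rule GL2_mult)
    show "g \<otimes>\<^bsub>PGL2\<^esub> uni s \<otimes>\<^bsub>PGL2\<^esub> inv\<^bsub>PGL2\<^esub> g = proj (M s)"
      unfolding inv unfolding M_def uni_def A(2)
      by (simp only: proj_mult[OF A(1) uni_matrix_in_GL2] proj_mult[OF AU B])
  qed
  have "openin (top_of_set (carrier GL2)) {A \<in> carrier GL2. proj A \<in> K}"
    using assms(1) by (simp only: openin_PGL2_top)
  then obtain T where T: "open T" "{A \<in> carrier GL2. proj A \<in> K} = carrier GL2 \<inter> T"
    unfolding openin_open by (elim exE conjE) (rule that)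
  have "continuous_on UNIV (\<lambda>s. mat2 1 s 0 1 :: 'a ^ 2 ^ 2)"
  proof -
    have "(\<lambda>s. mat2 1 s 0 1 :: 'a ^ 2 ^ 2) =
        (\<lambda>s. \<chi> i j. if i = 1 \<and> j = 2 then s else if i = j then 1 else 0)"
      by (simp add: fun_eq_iff vec_eq_iff forall_2)
    moreover have "continuous_on UNIV (\<lambda>s::'a. if P then s else if Q then 1 else 0)" for P Q
      by (cases P; cases Q) simp_all
    ultimately show ?thesis
      by (simp only: continuous_on_vec_lambda)
  qed
  then have "continuous_on UNIV M"
    unfolding M_def by (intro continuous_on_matrix_mult continuous_on_const)
  then have "open (M -` T)"
    using T(1) by (simp add: continuous_on_open_vimage)
  moreover have "M 0 = mat 1"
    using AB(1) by (simp add: M_def mat_eq_mat2[of 1, symmetric])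
  then have "0 \<in> M -` T"
    using T(2) conj(1)[of 0] one assms(2) by auto
  ultimately obtain \<delta> where \<delta>: "\<delta> > 0" "ball 0 \<delta> \<subseteq> M -` T"
    by (meson open_contains_ball)
  have "g \<otimes>\<^bsub>PGL2\<^esub> uni s \<otimes>\<^bsub>PGL2\<^esub> inv\<^bsub>PGL2\<^esub> g \<in> K" if "absval s < \<delta>" for s
  proof -
    have "M s \<in> T"
      using that \<delta>(2) by (auto simp: dist_commute)
    then have "M s \<in> {A \<in> carrier GL2. proj A \<in> K}"
      unfolding T(2) using conj(1) by (intro IntI)
    then show ?thesis
      by (simp add: conj(2))
  qed
  then show ?thesis
    using that \<delta>(1) by blast
qed

subsection \<open>A height on \<open>G/T\<close>\<close>

text \<open>
  \<open>G/T\<close> is the space of pairs of distinct points of the projective line, given by the two columns.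
  The height is invariant under rescaling each column, and it blows up along \<open>g u(t)\<close> as
  \<open>t\<close> tends to infinity, where the two points collide.
\<close>

definition height :: "'a::nonarch_local_field ^ 2 ^ 2 \<Rightarrow> real" where
  "height A = (absval (A $ 1 $ 1) + absval (A $ 2 $ 1)) * (absval (A $ 1 $ 2) + absval (A $ 2 $ 2)) /
     absval (det A)"

lemma height_mat2:
  "height (mat2 a b c d) =
    (absval a + absval c) * (absval b + absval d) / absval (a * d - b * c)"
  by (simp add: height_def det_2)

lemma height_mult_diag:
  assumes "p \<noteq> 0" "q \<noteq> 0"
  shows "height (A ** mat2 p 0 0 q) = height A"
proof (cases A rule: mat2_cases)
  case (1 a b c d)
  have "a * p * (d * q) - b * q * (c * p) = (a * d - b * c) * (p * q)"
    by (simp add: algebra_simps)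
  moreover have "(absval a * absval p + absval c * absval p) * (absval b * absval q + absval d * absval q) =
      (absval a + absval c) * (absval b + absval d) * (absval p * absval q)"
    by (simp add: algebra_simps)
  ultimately show ?thesis
    using assms by (simp add: 1 mat2_mult height_mat2 absval_mult)
qed

lemma height_proj_eq:
  assumes "A \<in> carrier GL2" "B \<in> carrier GL2" "proj A = proj B"
  shows "height A = height B"
proof -
  obtain c where c: "c \<noteq> 0" "B = mat c ** A"
    using assms proj_eq_iff by blast
  have "mat c ** A = A ** mat2 c 0 0 c"
    unfolding mat_eq_mat2[symmetric] mat_mult_left mat_mult_right ..
  then show ?thesis
    using c height_mult_diag by metis
qed

lemma continuous_on_height: "continuous_on (carrier GL2) height"
  unfolding height_def[abs_def] det_2
  by (intro continuous_intros) (auto simp: in_GL2_iff det_2)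

lemma height_bounded_on_compact:
  fixes C :: "'a::nonarch_local_field pgl2 set"
  assumes "compactin PGL2_top C"
  obtains M where "\<And>A. A \<in> carrier GL2 \<Longrightarrow> proj A \<in> C \<Longrightarrow> height A < M"
proof -
  define S where "S n = proj ` {A \<in> carrier GL2. height (A :: 'a ^ 2 ^ 2) < real n}" for n
  have pre: "{A \<in> carrier GL2. proj A \<in> S n} = {A \<in> carrier GL2. height A < real n}" for n
  proof (intro Collect_cong conj_cong refl)
    fix A :: "'a ^ 2 ^ 2" assume A: "A \<in> carrier GL2"
    show "proj A \<in> S n \<longleftrightarrow> height A < real n"
    proof
      assume "proj A \<in> S n"
      then obtain B where "B \<in> carrier GL2" "height B < real n" "proj A = proj B"
        unfolding S_def by (elim imageE CollectE conjE) (rule that)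
      then show "height A < real n"
        using height_proj_eq[OF A] by simp
    next
      assume "height A < real n"
      with A show "proj A \<in> S n"
        unfolding S_def by (intro imageI CollectI conjI)
    qed
  qed
  have "openin PGL2_top (S n)" for n
  proof -
    have "openin (top_of_set (carrier GL2)) (carrier GL2 \<inter> height -` {..<real n})"
      using continuous_on_height by (rule continuous_openin_preimage_gen) simp
    then show ?thesis
      unfolding openin_PGL2_top pre by (auto simp: S_def carrier_PGL2 vimage_def Int_def)
  qed
  moreover have "C \<subseteq> (\<Union>n. S n)"
  proof
    fix g assume "g \<in> C"
    then have "g \<in> carrier PGL2"
      using compactin_subset_topspace[OF assms] by auto
    then obtain A where "A \<in> carrier GL2" "g = proj A"
      by (auto simp: carrier_PGL2)
    moreover obtain n where "height A < real n"
      using reals_Archimedean2 by blast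
    ultimately show "g \<in> (\<Union>n. S n)"
      by (auto simp: S_def)
  qed
  ultimately obtain \<F> where F: "finite \<F>" "\<F> \<subseteq> range S" "C \<subseteq> \<Union>\<F>"
    using compactinD[OF assms, of "range S"] by auto
  then obtain N where N: "finite N" "\<F> = S ` N"
    by (meson finite_subset_image)
  have "height A < real (Max (insert 0 N))" if A: "A \<in> carrier GL2" "proj A \<in> C" for A
  proof -
    obtain n where "n \<in> N" "proj A \<in> S n"
      using F(3) N(2) A(2) by auto
    then have "height A < real n" "n \<le> Max (insert 0 N)"
      using pre[of n] A(1) N(1) by auto
    then show ?thesis by linarith
  qed
  then show ?thesis using that by blast
qed

lemma height_mult_uni_bounded:
  assumes A: "A \<in> carrier GL2"
  obtains R where "\<And>t. height (A ** mat2 1 t 0 1) < M \<Longrightarrow> absval t \<le> R"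
proof (cases A rule: mat2_cases)
  case (1 a b c d)
  define D where "D = absval (a * d - b * c)"
  define p where "p = absval a + absval c"
  have det: "a * d - b * c \<noteq> 0"
    using A by (simp add: 1 mat2_in_GL2_iff)
  then have D: "D > 0"
    by (simp add: D_def)
  have "a \<noteq> 0 \<or> c \<noteq> 0"
    using det by auto
  then have p: "p > 0"
    unfolding p_def by (auto intro: add_pos_nonneg add_nonneg_pos)
  have "absval t \<le> (M * D / p + (absval b + absval d)) / p"
    if t: "height (A ** mat2 1 t 0 1) < M" for t
  proof -
    have "a * (c * t + d) - (a * t + b) * c = a * d - b * c"
      by (simp add: algebra_simps)
    then have "p * (absval (a * t + b) + absval (c * t + d)) / D < M"
      using t by (simp add: 1 mat2_mult height_mat2 D_def p_def)
    then have "absval (a * t + b) + absval (c * t + d) \<le> M * D / p"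
      using D p by (simp add: field_simps)
    moreover have "p * absval t = absval (a * t) + absval (c * t)"
      by (simp add: p_def absval_mult distrib_right)
    ultimately have "p * absval t \<le> M * D / p + (absval b + absval d)"
      using absval_le_add_diff[of "a * t" b] absval_le_add_diff[of "c * t" d] by linarith
    then show ?thesis
      using p by (simp add: pos_le_divide_eq mult.commute)
  qed
  then show ?thesis using that by blast
qed

section \<open>The Whittaker map\<close>

lemma cind_torus_schwartz:
  fixes f :: "'a::nonarch_local_field pgl2 \<Rightarrow> complex"
  assumes f: "f \<in> cind_torus" and g: "g \<in> carrier PGL2"
  shows "schwartz (\<lambda>t. f (g \<otimes>\<^bsub>PGL2\<^esub> uni t))"
  unfolding schwartz_def
proof
  interpret PGL2: group "PGL2 :: 'a pgl2 monoid" by (rule group_PGL2)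
  have "smooth_fun f"
    using f by (simp add: cind_torus_def compact_Ind_def smooth_Ind_def)
  then obtain K where K: "subgroup K PGL2" "openin PGL2_top K"
    "\<forall>k\<in>K. \<forall>g\<in>carrier PGL2. f (k \<otimes>\<^bsub>PGL2\<^esub> g) = f g"
    unfolding smooth_fun_def by blast
  obtain \<delta> where \<delta>: "\<delta> > 0"
    "\<And>s. absval s < \<delta> \<Longrightarrow> g \<otimes>\<^bsub>PGL2\<^esub> uni s \<otimes>\<^bsub>PGL2\<^esub> inv\<^bsub>PGL2\<^esub> g \<in> K"
    using conjugate_uni_in_open[OF K(2) subgroup.one_closed[OF K(1)] g] by blast
  have "f (g \<otimes>\<^bsub>PGL2\<^esub> uni (t + s)) = f (g \<otimes>\<^bsub>PGL2\<^esub> uni t)" if "absval s < \<delta>" for t s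
  proof -
    have "g \<otimes>\<^bsub>PGL2\<^esub> uni (t + s) =
        (g \<otimes>\<^bsub>PGL2\<^esub> uni s \<otimes>\<^bsub>PGL2\<^esub> inv\<^bsub>PGL2\<^esub> g) \<otimes>\<^bsub>PGL2\<^esub> (g \<otimes>\<^bsub>PGL2\<^esub> uni t)"
    proof -
      have "inv\<^bsub>PGL2\<^esub> g \<otimes>\<^bsub>PGL2\<^esub> (g \<otimes>\<^bsub>PGL2\<^esub> uni t) = uni t"
        using g uni_in_PGL2[of t] by (simp add: PGL2.m_assoc[symmetric])
      then show ?thesis
        using g uni_in_PGL2[of s] uni_in_PGL2[of t] uni_add[of s t]
        by (simp add: PGL2.m_assoc add.commute[of t])
    qed
    then show ?thesis
      by (simp only: K(3)[rule_format, OF \<delta>(2)[OF that] PGL2.m_closed[OF g uni_in_PGL2]])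
  qed
  then show "\<exists>\<delta>>0. \<forall>t s. absval s < \<delta> \<longrightarrow> f (g \<otimes>\<^bsub>PGL2\<^esub> uni (t + s)) = f (g \<otimes>\<^bsub>PGL2\<^esub> uni t)"
    using \<delta>(1) by blast
next
  interpret PGL2: group "PGL2 :: 'a pgl2 monoid" by (rule group_PGL2)
  have "\<exists>C. compactin PGL2_top C \<and> {g \<in> carrier PGL2. f g \<noteq> 0} \<subseteq> C <#>\<^bsub>PGL2\<^esub> torus"
    using f by (simp add: cind_torus_def compact_Ind_def)
  then obtain C where C: "compactin PGL2_top C" "{g \<in> carrier PGL2. f g \<noteq> 0} \<subseteq> C <#>\<^bsub>PGL2\<^esub> torus"
    by (elim exE conjE) (rule that)
  obtain M where M: "\<And>A. A \<in> carrier GL2 \<Longrightarrow> proj A \<in> C \<Longrightarrow> height A < M"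
    using height_bounded_on_compact[OF C(1)] by blast
  obtain A where A: "A \<in> carrier GL2" "g = proj A"
    using g by (auto simp: carrier_PGL2)
  obtain R where R: "\<And>t. height (A ** mat2 1 t 0 1) < M \<Longrightarrow> absval t \<le> R"
    using height_mult_uni_bounded[OF A(1)] by blast
  have "absval t \<le> R" if t: "f (g \<otimes>\<^bsub>PGL2\<^esub> uni t) \<noteq> 0" for t
  proof -
    have At: "A ** mat2 1 t 0 1 \<in> carrier GL2"
      using A(1) uni_matrix_in_GL2 by (rule GL2_mult)
    have gt: "g \<otimes>\<^bsub>PGL2\<^esub> uni t = proj (A ** mat2 1 t 0 1)"
      unfolding A(2) uni_def using A(1) uni_matrix_in_GL2 by (rule proj_mult)
    have "g \<otimes>\<^bsub>PGL2\<^esub> uni t \<in> C <#>\<^bsub>PGL2\<^esub> torus"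
      using t PGL2.m_closed[OF g uni_in_PGL2, of t] by (intro subsetD[OF C(2)] CollectI conjI)
    then obtain c p q where c: "c \<in> C" "p \<noteq> 0" "q \<noteq> 0"
      "g \<otimes>\<^bsub>PGL2\<^esub> uni t = c \<otimes>\<^bsub>PGL2\<^esub> proj (mat2 p 0 0 q)"
      by (auto simp: set_mult_def torus_def)
    then obtain B where B: "B \<in> carrier GL2" "c = proj B"
      using compactin_subset_topspace[OF C(1)] by (auto simp: carrier_PGL2)
    have D: "mat2 p 0 0 q \<in> carrier GL2"
      using c(2,3) by (simp add: mat2_in_GL2_iff)
    then have "B ** mat2 p 0 0 q \<in> carrier GL2"
      using B(1) by (intro GL2_mult)
    moreover have "proj (A ** mat2 1 t 0 1) = proj (B ** mat2 p 0 0 q)"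
      using c(4) gt B(2) proj_mult[OF B(1) D] by simp
    ultimately have "height (A ** mat2 1 t 0 1) = height B"
      using height_proj_eq[OF At] height_mult_diag c(2,3) by metis
    then show ?thesis
      using M[OF B(1)] c(1) B(2) R by simp
  qed
  then show "\<exists>R. \<forall>t. f (g \<otimes>\<^bsub>PGL2\<^esub> uni t) \<noteq> 0 \<longrightarrow> absval t \<le> R"
    by blast
qed

lemma cindD:
  fixes f :: "'a::nonarch_local_field pgl2 \<Rightarrow> complex"
  assumes "f \<in> cind_torus"
  shows cind_extensional: "f \<in> carrier PGL2 \<rightarrow>\<^sub>E UNIV"
    and cind_smooth: "smooth_fun f"
    and cind_torus_invariant: "\<lbrakk>g \<in> carrier PGL2; h \<in> torus\<rbrakk> \<Longrightarrow> f (g \<otimes>\<^bsub>PGL2\<^esub> h) = f g"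
  using assms by (simp_all add: cind_torus_def compact_Ind_def smooth_Ind_def)

lemma whittaker_integrand_schwartz:
  assumes "smooth_character \<psi>" "f \<in> cind_torus" "g \<in> carrier PGL2"
  shows "schwartz (\<lambda>t. f (g \<otimes>\<^bsub>PGL2\<^esub> uni t) * cnj (\<psi> t))"
  using schwartz_mult_character[OF assms(1) cind_torus_schwartz[OF assms(2,3)], of "- 1"]
  by (simp add: cnj_character[OF assms(1)])

lemma whittaker_map_in_Wh:
  fixes \<psi> :: "'a::nonarch_local_field \<Rightarrow> complex"
  assumes \<psi>: "smooth_character \<psi>" and \<mu>: "haar_measure \<mu>" and f: "f \<in> cind_torus"
  shows "whittaker_map \<mu> \<psi> f \<in> Wh \<psi>"
proof -
  interpret PGL2: group "PGL2 :: 'a pgl2 monoid" by (rule group_PGL2)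
  have "smooth_fun (whittaker_map \<mu> \<psi> f)"
  proof -
    obtain K where K: "subgroup K PGL2" "openin PGL2_top K"
      "\<forall>k\<in>K. \<forall>g\<in>carrier PGL2. f (k \<otimes>\<^bsub>PGL2\<^esub> g) = f g"
      using cind_smooth[OF f] unfolding smooth_fun_def by blast
    have "whittaker_map \<mu> \<psi> f (k \<otimes>\<^bsub>PGL2\<^esub> g) = whittaker_map \<mu> \<psi> f g"
      if k: "k \<in> K" and g: "g \<in> carrier PGL2" for k g
    proof -
      have k': "k \<in> carrier PGL2"
        using K(1) k by (rule subgroup.mem_carrier)
      have "f (k \<otimes>\<^bsub>PGL2\<^esub> g \<otimes>\<^bsub>PGL2\<^esub> uni t) = f (g \<otimes>\<^bsub>PGL2\<^esub> uni t)" for t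
        using K(3)[rule_format, OF k PGL2.m_closed[OF g uni_in_PGL2]]
        by (simp only: PGL2.m_assoc[OF k' g uni_in_PGL2])
      then show ?thesis
        using k' g by (simp add: whittaker_map_def)
    qed
    then show ?thesis
      unfolding smooth_fun_def using K(1,2) by blast
  qed
  moreover have "whittaker_map \<mu> \<psi> f (g \<otimes>\<^bsub>PGL2\<^esub> h) = theta \<psi> h * whittaker_map \<mu> \<psi> f g"
    if g: "g \<in> carrier PGL2" and h: "h \<in> unipotent" for g h
  proof -
    obtain s where s: "h = uni s"
      using h by (auto simp: unipotent_def)
    define \<phi> where "\<phi> t = f (g \<otimes>\<^bsub>PGL2\<^esub> uni t) * cnj (\<psi> t)" for t
    have int: "integrable \<mu> \<phi>"
      unfolding \<phi>_def using schwartz_integrable[OF whittaker_integrand_schwartz[OF \<psi> f g] \<mu>] .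
    have "f (g \<otimes>\<^bsub>PGL2\<^esub> h \<otimes>\<^bsub>PGL2\<^esub> uni t) * cnj (\<psi> t) = \<psi> s * \<phi> (s + t)" for t
    proof -
      have "g \<otimes>\<^bsub>PGL2\<^esub> h \<otimes>\<^bsub>PGL2\<^esub> uni t = g \<otimes>\<^bsub>PGL2\<^esub> uni (s + t)"
        using g by (simp add: s PGL2.m_assoc uni_in_PGL2 uni_add)
      moreover have "\<psi> s * cnj (\<psi> (s + t)) = cnj (\<psi> t)"
        using character_add[OF \<psi>, of s "- (s + t)"] by (simp add: cnj_character[OF \<psi>])
      ultimately show ?thesis
        by (simp add: \<phi>_def mult.left_commute)
    qed
    then have "(\<integral>t. f (g \<otimes>\<^bsub>PGL2\<^esub> h \<otimes>\<^bsub>PGL2\<^esub> uni t) * cnj (\<psi> t) \<partial>\<mu>) = \<psi> s * (\<integral>t. \<phi> (s + t) \<partial>\<mu>)"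
      by (simp only: integral_mult_right_zero)
    also have "\<dots> = \<psi> s * (\<integral>t. \<phi> t \<partial>\<mu>)"
      using haar_integral_translate[OF \<mu> int] by simp
    finally show ?thesis
      using g by (simp add: whittaker_map_def \<phi>_def s uni_in_PGL2)
  qed
  ultimately show ?thesis
    by (simp add: Wh_def smooth_Ind_def whittaker_map_def)
qed

lemma whittaker_map_linear:
  fixes f1 f2 :: "'a::nonarch_local_field pgl2 \<Rightarrow> complex"
  assumes \<psi>: "smooth_character \<psi>" and \<mu>: "haar_measure \<mu>" and f: "f1 \<in> cind_torus" "f2 \<in> cind_torus"
  shows "whittaker_map \<mu> \<psi> (\<lambda>g\<in>carrier PGL2. a * f1 g + b * f2 g) =
    (\<lambda>g\<in>carrier PGL2. a * whittaker_map \<mu> \<psi> f1 g + b * whittaker_map \<mu> \<psi> f2 g)"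
proof -
  interpret PGL2: group "PGL2 :: 'a pgl2 monoid" by (rule group_PGL2)
  have "(\<integral>t. (\<lambda>g\<in>carrier PGL2. a * f1 g + b * f2 g) (g \<otimes>\<^bsub>PGL2\<^esub> uni t) * cnj (\<psi> t) \<partial>\<mu>) =
      a * (\<integral>t. f1 (g \<otimes>\<^bsub>PGL2\<^esub> uni t) * cnj (\<psi> t) \<partial>\<mu>) + b * (\<integral>t. f2 (g \<otimes>\<^bsub>PGL2\<^esub> uni t) * cnj (\<psi> t) \<partial>\<mu>)"
    if g: "g \<in> carrier PGL2" for g
  proof -
    have "(\<lambda>g\<in>carrier PGL2. a * f1 g + b * f2 g) (g \<otimes>\<^bsub>PGL2\<^esub> uni t) * cnj (\<psi> t) =
        a * (f1 (g \<otimes>\<^bsub>PGL2\<^esub> uni t) * cnj (\<psi> t)) + b * (f2 (g \<otimes>\<^bsub>PGL2\<^esub> uni t) * cnj (\<psi> t))" for t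
      using g uni_in_PGL2[of t] by (simp add: distrib_right mult.assoc)
    then show ?thesis
      using f[THEN whittaker_integrand_schwartz[OF \<psi> _ g], THEN schwartz_integrable[OF _ \<mu>]]
      by simp
  qed
  then show ?thesis
    unfolding whittaker_map_def by (intro restrict_ext) simp
qed

lemma whittaker_map_left_translate:
  fixes f :: "'a::nonarch_local_field pgl2 \<Rightarrow> complex"
  assumes h: "h \<in> carrier PGL2"
  shows "whittaker_map \<mu> \<psi> (left_translate h f) = left_translate h (whittaker_map \<mu> \<psi> f)"
proof -
  interpret PGL2: group "PGL2 :: 'a pgl2 monoid" by (rule group_PGL2)
  have "left_translate h f (g \<otimes>\<^bsub>PGL2\<^esub> uni t) = f (inv\<^bsub>PGL2\<^esub> h \<otimes>\<^bsub>PGL2\<^esub> g \<otimes>\<^bsub>PGL2\<^esub> uni t)"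
    if "g \<in> carrier PGL2" for g t
    using h that uni_in_PGL2[of t] by (simp add: left_translate_def PGL2.m_assoc)
  then show ?thesis
    using h unfolding whittaker_map_def left_translate_def[of h "restrict _ _"]
    by (intro restrict_ext) simp
qed

lemma inj_on_whittaker_map:
  fixes \<psi> :: "'a::nonarch_local_field \<Rightarrow> complex"
  assumes \<psi>: "smooth_character \<psi>" "\<exists>x. \<psi> x \<noteq> 1" and \<mu>: "haar_measure \<mu>"
  shows "inj_on (whittaker_map \<mu> \<psi>) cind_torus"
proof (rule inj_onI)
  interpret PGL2: group "PGL2 :: 'a pgl2 monoid" by (rule group_PGL2)
  fix f1 f2 :: "'a pgl2 \<Rightarrow> complex"
  assume f: "f1 \<in> cind_torus" "f2 \<in> cind_torus"
    and eq: "whittaker_map \<mu> \<psi> f1 = whittaker_map \<mu> \<psi> f2"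
  have "f1 g = f2 g" if g: "g \<in> carrier PGL2" for g
  proof -
    define \<phi> where "\<phi> t = f1 (g \<otimes>\<^bsub>PGL2\<^esub> uni t) - f2 (g \<otimes>\<^bsub>PGL2\<^esub> uni t)" for t
    have sch: "schwartz \<phi>"
      unfolding \<phi>_def by (intro schwartz_diff cind_torus_schwartz f g)
    have "(\<integral>t. \<phi> (a * t) * cnj (\<psi> t) \<partial>\<mu>) = 0" if a: "a \<noteq> 0" for a
    proof -
      define d where "d = proj (mat2 a 0 0 1)"
      have "d \<in> torus"
        unfolding d_def torus_def
        by (intro CollectI exI[of _ a] exI[of _ 1] conjI refl a one_neq_zero)
      moreover have "d \<in> carrier PGL2"
        unfolding d_def carrier_PGL2 using a by (intro imageI) (simp add: mat2_in_GL2_iff)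
      ultimately have d: "d \<in> torus" "d \<in> carrier PGL2" .
      have gd: "g \<otimes>\<^bsub>PGL2\<^esub> d \<in> carrier PGL2"
        using g d(2) by (rule PGL2.m_closed)
      have dilate: "f (g \<otimes>\<^bsub>PGL2\<^esub> d \<otimes>\<^bsub>PGL2\<^esub> uni t) = f (g \<otimes>\<^bsub>PGL2\<^esub> uni (a * t))"
        if "f \<in> cind_torus" for f :: "'a pgl2 \<Rightarrow> complex" and t
      proof -
        have "g \<otimes>\<^bsub>PGL2\<^esub> d \<otimes>\<^bsub>PGL2\<^esub> uni t = g \<otimes>\<^bsub>PGL2\<^esub> uni (a * t) \<otimes>\<^bsub>PGL2\<^esub> d"
          using g d(2) diag_uni[OF a, of t]
          by (simp add: d_def[symmetric] PGL2.m_assoc uni_in_PGL2)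
        then show ?thesis
          using cind_torus_invariant[OF that PGL2.m_closed[OF g uni_in_PGL2] d(1)] by simp
      qed
      have "integrable \<mu> (\<lambda>t. f (g \<otimes>\<^bsub>PGL2\<^esub> uni (a * t)) * cnj (\<psi> t))"
        if "f \<in> cind_torus" for f :: "'a pgl2 \<Rightarrow> complex"
        using schwartz_integrable[OF whittaker_integrand_schwartz[OF \<psi>(1) that gd] \<mu>]
        by (simp add: dilate[OF that])
      then have "(\<integral>t. \<phi> (a * t) * cnj (\<psi> t) \<partial>\<mu>) =
          (\<integral>t. f1 (g \<otimes>\<^bsub>PGL2\<^esub> uni (a * t)) * cnj (\<psi> t) \<partial>\<mu>) -
          (\<integral>t. f2 (g \<otimes>\<^bsub>PGL2\<^esub> uni (a * t)) * cnj (\<psi> t) \<partial>\<mu>)"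
        using f by (simp add: \<phi>_def left_diff_distrib)
      also have "\<dots> = whittaker_map \<mu> \<psi> f1 (g \<otimes>\<^bsub>PGL2\<^esub> d) - whittaker_map \<mu> \<psi> f2 (g \<otimes>\<^bsub>PGL2\<^esub> d)"
        using gd by (simp add: whittaker_map_def dilate[OF f(1)] dilate[OF f(2)])
      finally show ?thesis
        by (simp add: eq)
    qed
    then have "\<phi> 0 = 0"
      by (rule schwartz_eq_0_if_dilates_orthogonal[OF \<psi> sch \<mu>])
    moreover have "uni 0 = \<one>\<^bsub>PGL2 :: 'a pgl2 monoid\<^esub>"
      using PGL2.r_cancel_one[OF uni_in_PGL2 uni_in_PGL2, of 0 0] uni_add[of "0::'a" 0] by simp
    ultimately show ?thesis
      using g by (simp add: \<phi>_def)
  qed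
  then show "f1 = f2"
    using cind_extensional[OF f(1)] cind_extensional[OF f(2)] by (rule PiE_ext[rotated 2])
qed

theorem mainTheorem4:
  fixes \<psi> :: "'a::nonarch_local_field \<Rightarrow> complex"
  assumes "smooth_character \<psi>"
    and "\<exists>x. \<psi> x \<noteq> 1"
  shows "(\<forall>f \<in> (cind_torus :: ('a pgl2 \<Rightarrow> complex) set). \<forall>g \<in> carrier PGL2.
            locally_constant (\<lambda>t. f (g \<otimes>\<^bsub>PGL2\<^esub> uni t)) \<and>
            compactly_supported (\<lambda>t. f (g \<otimes>\<^bsub>PGL2\<^esub> uni t))) \<and>
         (\<forall>\<mu>. haar_measure \<mu> \<longrightarrow>
            whittaker_map \<mu> \<psi> \<in> cind_torus \<rightarrow> Wh \<psi> \<and>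
            (\<forall>f1 \<in> cind_torus. \<forall>f2 \<in> cind_torus. \<forall>a b.
               whittaker_map \<mu> \<psi> (\<lambda>g\<in>carrier PGL2. a * f1 g + b * f2 g) =
               (\<lambda>g\<in>carrier PGL2. a * whittaker_map \<mu> \<psi> f1 g + b * whittaker_map \<mu> \<psi> f2 g)) \<and>
            (\<forall>h \<in> carrier PGL2. \<forall>f \<in> cind_torus.
               whittaker_map \<mu> \<psi> (left_translate h f) = left_translate h (whittaker_map \<mu> \<psi> f)) \<and>
            inj_on (whittaker_map \<mu> \<psi>) cind_torus)"
  using assms schwartz_locally_constant[OF cind_torus_schwartz]
    schwartz_compactly_supported[OF cind_torus_schwartz]
  by (intro conjI ballI allI impI Pi_I whittaker_map_in_Wh whittaker_map_linear
      whittaker_map_left_translate inj_on_whittaker_map)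

end
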